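(* Let $(\mathbf{G},\boldsymbol{\lambda},\varkappa)$ be a measured groupoid. If $(P_n)$ is a sequence of equivariant transition operators on $\mathbf{G}$ which satisfies the integral strong asymptotic invariance (ISAI) condition, then for any other equivariant transition operator $Q$ with absolutely continuous transition probabilities the sequence $(QP_n)$ also satisfies the ISAI condition.
   Context: Groupoids. A groupoid $\mathbf{G}$ is a small category in which each morphism is an isomorphism; $X$ is its set of objects and $\mathbf{G}$ also denotes its set of morphisms. The source and target of $g\in\mathbf{G}$ are $\underline{g}\in X$ and $\overline{g}\in X$. The product $gg'$ is defined exactly when $\underline{g}=\overline{g'}$ (set $\mathbf{G}^{(2)}$ of composable pairs), and $\underline{gg'}=\underline{g'}$, $\overline{gg'}=\overline{g}$. Objects $x\in X$ are identified with the identity morphisms $\epsilon_x\in\mathbf{G}$. The target fibre over $x$ is $\mathbf{G}^x=\{g\in\mathbf{G}:\overline{g}=x\}$. Left multiplication by $g$ is a bijection $\mathbf{G}^{\underline{g}}\to\mathbf{G}^{\overline{g}}$, and for a measure $\alpha$ on $\mathbf{G}^{\underline g}$, $g\alpha$ denotes its image under this map. Measured groupoids. All measure spaces are Lebesgue–Rokhlin spaces and all measures are finite or $\sigma$-finite. A groupoid is measurable if its set of morphisms carries a $\sigma$-algebra such that all structure maps (source, target, composition, unit inclusion, inversion) are measurable, where $X$ and $\mathbf{G}^{(2)}$ carry the pullback $\sigma$-algebras under $X\hookrightarrow\mathbf{G}$ and $\mathbf{G}^{(2)}\hookrightarrow\mathbf{G}\times\mathbf{G}$. A measurable target fibred system of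 measures is a family $\{\lambda^x\}_{x\in X}$, $\lambda^x$ a measure on $\mathbf{G}^x$, such that $x\mapsto\langle f,\lambda^x\rangle=\int f\,d\lambda^x$ is measurable for every non-negative measurable $f$ on $\mathbf{G}$. A Haar system is such a system $\boldsymbol{\lambda}=\{\lambda^x\}$ which is left invariant ($g\lambda^{\underline g}=\lambda^{\overline g}$ for all $g\in\mathbf{G}$) and proper (there is a non-negative measurable $f$ on $\mathbf{G}$ with $\langle f,\lambda^x\rangle=1$ for all $x\in X$). For a measure $\varkappa$ on $X$, $\boldsymbol{\lambda}\star\varkappa$ is the measure $\int\lambda^x\,d\varkappa(x)$ on $\mathbf{G}$; $\varkappa$ is quasi-invariant if $g\mapsto g^{-1}$ preserves the $(\boldsymbol{\lambda}\star\varkappa)$-negligible sets. A measured groupoid is a triple $(\mathbf{G},\boldsymbol{\lambda},\varkappa)$ with $\mathbf{G}$ a measurable groupoid, $\boldsymbol{\lambda}$ a Haar system and $\varkappa$ a quasi-invariant measure on $X$. Equivariant transition operators. A measurable family of transition probabilities $\{\pi^g\}_{g\in\mathbf{G}}$ on $\mathbf{G}$ (i.e. $g\mapsto\langle f,\pi^g\rangle$ is measurable for every measurable $f$ on $\mathbf{G}$ for which this makes sense) is equivariant if $\pi^g(\mathbf{G}^{\overline g})=1$ for all $g\in\mathbf{G}$ and $\pi^{gg'}=g\,\pi^{g'}$ for all $(g,g')\in\mathbf{G}^{(2)}$. The associated equivariant transition operator $P$ acts by $Pf(g)=\langle f,\pi^g\rangle$ on functions and $\alpha P=\int\pi^g\,d\alpha(g)$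 on measures; products are operator products, so that $\alpha(QP)=(\alpha Q)P$ for measures $\alpha$. $P$ has absolutely continuous transition probabilities if $\pi^g\prec\lambda^{\overline g}$ for all $g\in\mathbf{G}$. Discrepancy and ISAI. The discrepancy function of $P$ is $\Delta(g,P)=\|\pi^g-\pi^{\overline g}\|=\|(\delta_g-\delta_{\overline g})P\|$, $g\in\mathbf{G}$, with $\|\cdot\|$ the total variation norm. A sequence $(P_n)$ of equivariant transition operators satisfies the integral strong asymptotic invariance (ISAI) condition if $\Delta(\cdot,P_n)\to0$ in the weak$^*$ topology $\sigma(L^\infty,L^1)$ of $L^\infty(\mathbf{G},\boldsymbol{\lambda}\star\varkappa)$, i.e. $\int\Delta(g,P_n)\,dm(g)\to0$ for every probability measure $m\prec\boldsymbol{\lambda}\star\varkappa$. *)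

theory Defs
  imports "HOL-Probability.Probability"
begin

section \<open>Lebesgue--Rokhlin spaces\<close>

definition isomorphic_mod_0 :: "'a measure \<Rightarrow> 'b measure \<Rightarrow> bool" where
  "isomorphic_mod_0 \<mu> \<nu> \<longleftrightarrow> (\<exists>f S T.
     S \<subseteq> space \<mu> \<and> space \<mu> - S \<in> null_sets (completion \<mu>) \<and>
     T \<subseteq> space \<nu> \<and> space \<nu> - T \<in> null_sets (completion \<nu>) \<and>
     bij_betw f S T \<and>
     (\<forall>A. A \<subseteq> S \<longrightarrow> (A \<in> sets (completion \<mu>) \<longleftrightarrow> f ` A \<in> sets (completion \<nu>))) \<and>
     (\<forall>A. A \<subseteq> S \<longrightarrow> A \<in> sets (completion \<mu>) \<longrightarrow>
        emeasure (completion \<mu>) A = emeasure (completion \<nu>) (f ` A)))"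

text \<open>
  The model space: Lebesgue measure on the interval from 0 to c (a half-line if c is infinite, empty
  if c = 0), together with countably many atoms, placed at the negative integers; the k-th atom is
  absent when its weight w k is 0.
\<close>

definition rokhlin_model :: "ennreal \<Rightarrow> (nat \<Rightarrow> ennreal) \<Rightarrow> real measure \<Rightarrow> bool" where
  "rokhlin_model c w \<nu> \<longleftrightarrow> sets \<nu> = sets borel \<and> (\<forall>k. w k < \<infinity>) \<and>
     (\<forall>A\<in>sets borel. emeasure \<nu> A =
        emeasure lborel (A \<inter> {x. 0 < x \<and> ennreal x < c}) +
        (\<Sum>k. w k * indicator A (- real (Suc k))))"

definition lebesgue_rokhlin :: "'a measure \<Rightarrow> bool" where
  "lebesgue_rokhlin \<mu> \<longleftrightarrow> (\<exists>c w \<nu>. rokhlin_model c w \<nu> \<and> isomorphic_mod_0 \<mu> \<nu>)"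

text \<open>
  The standing convention that all measure spaces are Lebesgue--Rokhlin spaces, as a property of a
  \<open>\<sigma>\<close>-algebra: whichever (finite or) \<open>\<sigma>\<close>-finite measure it is equipped with. Only
  the \<open>\<sigma>\<close>-algebra of the argument matters. Standard Borel spaces are examples.
\<close>

definition lebesgue_rokhlin_sigma_algebra :: "'a measure \<Rightarrow> bool" where
  "lebesgue_rokhlin_sigma_algebra M \<longleftrightarrow>
     (\<forall>\<mu>. sets \<mu> = sets M \<longrightarrow> sigma_finite_measure \<mu> \<longrightarrow> lebesgue_rokhlin \<mu>)"


section \<open>Groupoids\<close>

text \<open>The product \<open>cmp g h\<close> is meaningful only when \<open>src g = tgt h\<close>.\<close>

record ('x, 'g) groupoid_data =
  Obj :: "'x set"
  Mor :: "'g set"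
  src :: "'g \<Rightarrow> 'x"
  tgt :: "'g \<Rightarrow> 'x"
  cmp :: "'g \<Rightarrow> 'g \<Rightarrow> 'g"
  ident :: "'x \<Rightarrow> 'g"
  minv :: "'g \<Rightarrow> 'g"

locale groupoid =
  fixes G :: "('x, 'g) groupoid_data"
  assumes src_closed: "g \<in> Mor G \<Longrightarrow> src G g \<in> Obj G"
    and tgt_closed: "g \<in> Mor G \<Longrightarrow> tgt G g \<in> Obj G"
    and ident_closed: "x \<in> Obj G \<Longrightarrow> ident G x \<in> Mor G"
    and src_ident: "x \<in> Obj G \<Longrightarrow> src G (ident G x) = x"
    and tgt_ident: "x \<in> Obj G \<Longrightarrow> tgt G (ident G x) = x"
    and cmp_closed: "\<lbrakk>g \<in> Mor G; h \<in> Mor G; src G g = tgt G h\<rbrakk> \<Longrightarrow> cmp G g h \<in> Mor G"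
    and src_cmp: "\<lbrakk>g \<in> Mor G; h \<in> Mor G; src G g = tgt G h\<rbrakk> \<Longrightarrow> src G (cmp G g h) = src G h"
    and tgt_cmp: "\<lbrakk>g \<in> Mor G; h \<in> Mor G; src G g = tgt G h\<rbrakk> \<Longrightarrow> tgt G (cmp G g h) = tgt G g"
    and cmp_assoc: "\<lbrakk>g \<in> Mor G; h \<in> Mor G; k \<in> Mor G; src G g = tgt G h; src G h = tgt G k\<rbrakk>
           \<Longrightarrow> cmp G (cmp G g h) k = cmp G g (cmp G h k)"
    and cmp_ident_left: "g \<in> Mor G \<Longrightarrow> cmp G (ident G (tgt G g)) g = g"
    and cmp_ident_right: "g \<in> Mor G \<Longrightarrow> cmp G g (ident G (src G g)) = g"
    and minv_closed: "g \<in> Mor G \<Longrightarrow> minv G g \<in> Mor G"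
    and src_minv: "g \<in> Mor G \<Longrightarrow> src G (minv G g) = tgt G g"
    and tgt_minv: "g \<in> Mor G \<Longrightarrow> tgt G (minv G g) = src G g"
    and cmp_minv_left: "g \<in> Mor G \<Longrightarrow> cmp G (minv G g) g = ident G (src G g)"
    and cmp_minv_right: "g \<in> Mor G \<Longrightarrow> cmp G g (minv G g) = ident G (tgt G g)"

definition target_fibre :: "('x, 'g) groupoid_data \<Rightarrow> 'x \<Rightarrow> 'g set" where
  "target_fibre G x = {g \<in> Mor G. tgt G g = x}"

definition composable :: "('x, 'g) groupoid_data \<Rightarrow> ('g \<times> 'g) set" where
  "composable G = {(g, h). g \<in> Mor G \<and> h \<in> Mor G \<and> src G g = tgt G h}"


section \<open>Measured groupoids\<close>

text \<open>
  Throughout, \<open>M\<close> carries the \<open>\<sigma>\<close>-algebra on the set of morphisms; the measure component of \<open>M\<close>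
  plays no role. Objects get the pullback \<open>\<sigma>\<close>-algebra under \<open>x \<mapsto> ident G x\<close>.
\<close>

definition obj_space :: "('x, 'g) groupoid_data \<Rightarrow> 'g measure \<Rightarrow> 'x measure" where
  "obj_space G M = vimage_algebra (Obj G) (ident G) M"

locale measurable_groupoid = groupoid G
  for G :: "('x, 'g) groupoid_data" +
  fixes M :: "'g measure"
  assumes space_M: "space M = Mor G"
    and src_measurable: "src G \<in> M \<rightarrow>\<^sub>M obj_space G M"
    and tgt_measurable: "tgt G \<in> M \<rightarrow>\<^sub>M obj_space G M"
    and cmp_measurable:
      "(\<lambda>(g, h). cmp G g h) \<in> restrict_space (M \<Otimes>\<^sub>M M) (composable G) \<rightarrow>\<^sub>M M"
    and ident_measurable: "ident G \<in> obj_space G M \<rightarrow>\<^sub>M M"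
    and minv_measurable: "minv G \<in> M \<rightarrow>\<^sub>M M"
    and rokhlin_M: "lebesgue_rokhlin_sigma_algebra M"
    and rokhlin_obj: "lebesgue_rokhlin_sigma_algebra (obj_space G M)"

text \<open>
  Measures on a target fibre are represented by measures on all morphisms that are concentrated on
  the fibre. The image of such a measure (on the fibre over \<open>src g\<close>) under left multiplication by
  \<open>g\<close>:
\<close>

definition left_translate ::
    "('x, 'g) groupoid_data \<Rightarrow> 'g measure \<Rightarrow> 'g \<Rightarrow> 'g measure \<Rightarrow> 'g measure" where
  "left_translate G M g \<alpha> = distr (restrict_space \<alpha> (target_fibre G (src G g))) M (cmp G g)"

definition fibred_system ::
    "('x, 'g) groupoid_data \<Rightarrow> 'g measure \<Rightarrow> ('x \<Rightarrow> 'g measure) \<Rightarrow> bool" where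
  "fibred_system G M \<Lambda> \<longleftrightarrow>
     (\<forall>x\<in>Obj G. sets (\<Lambda> x) = sets M \<and> sigma_finite_measure (\<Lambda> x) \<and>
        (AE g in \<Lambda> x. g \<in> target_fibre G x)) \<and>
     (\<forall>f :: 'g \<Rightarrow> ennreal. f \<in> borel_measurable M \<longrightarrow>
        (\<lambda>x. \<integral>\<^sup>+ g. f g \<partial>\<Lambda> x) \<in> borel_measurable (obj_space G M))"

definition haar_system ::
    "('x, 'g) groupoid_data \<Rightarrow> 'g measure \<Rightarrow> ('x \<Rightarrow> 'g measure) \<Rightarrow> bool" where
  "haar_system G M \<Lambda> \<longleftrightarrow> fibred_system G M \<Lambda> \<and>
     (\<forall>g\<in>Mor G. left_translate G M g (\<Lambda> (src G g)) = \<Lambda> (tgt G g)) \<and>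
     (\<exists>f :: 'g \<Rightarrow> ennreal. f \<in> borel_measurable M \<and> (\<forall>x\<in>Obj G. (\<integral>\<^sup>+ g. f g \<partial>\<Lambda> x) = 1))"

definition star_measure :: "'g measure \<Rightarrow> ('x \<Rightarrow> 'g measure) \<Rightarrow> 'x measure \<Rightarrow> 'g measure" where
  "star_measure M \<Lambda> \<kappa> = measure_of (space M) (sets M) (\<lambda>A. \<integral>\<^sup>+ x. emeasure (\<Lambda> x) A \<partial>\<kappa>)"

definition quasi_invariant ::
    "('x, 'g) groupoid_data \<Rightarrow> 'g measure \<Rightarrow> ('x \<Rightarrow> 'g measure) \<Rightarrow> 'x measure \<Rightarrow> bool" where
  "quasi_invariant G M \<Lambda> \<kappa> \<longleftrightarrow>
     (\<forall>N\<in>null_sets (star_measure M \<Lambda> \<kappa>). minv G ` N \<in> null_sets (star_measure M \<Lambda> \<kappa>))"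

locale measured_groupoid = measurable_groupoid G M
  for G :: "('x, 'g) groupoid_data" and M :: "'g measure" +
  fixes \<Lambda> :: "'x \<Rightarrow> 'g measure" and \<kappa> :: "'x measure"
  assumes haar: "haar_system G M \<Lambda>"
    and sets_base: "sets \<kappa> = sets (obj_space G M)"
    and sigma_finite_base: "sigma_finite_measure \<kappa>"
    and sigma_finite_star: "sigma_finite_measure (star_measure M \<Lambda> \<kappa>)"
    and quasi_inv: "quasi_invariant G M \<Lambda> \<kappa>"

lemma sets_star_measure [simp]: "sets (star_measure M \<Lambda> \<kappa>) = sets M"
  and space_star_measure [simp]: "space (star_measure M \<Lambda> \<kappa>) = space M"
  by (simp_all add: star_measure_def)

lemma emeasure_star_measure:
  assumes fib: "fibred_system G M \<Lambda>" and \<kappa>: "sets \<kappa> = sets (obj_space G M)"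
    and A: "A \<in> sets M"
  shows "emeasure (star_measure M \<Lambda> \<kappa>) A = (\<integral>\<^sup>+ x. emeasure (\<Lambda> x) A \<partial>\<kappa>)"
proof -
  have sp: "space \<kappa> = Obj G"
    using sets_eq_imp_space_eq[OF \<kappa>] by (simp add: obj_space_def)
  have sL: "sets (\<Lambda> x) = sets M" if "x \<in> Obj G" for x
    using fib that by (auto simp: fibred_system_def)
  have meas: "(\<lambda>x. emeasure (\<Lambda> x) B) \<in> borel_measurable \<kappa>" if B: "B \<in> sets M" for B
  proof -
    have "(\<lambda>x. \<integral>\<^sup>+ g. indicator B g \<partial>\<Lambda> x) \<in> borel_measurable (obj_space G M)"
      using fib B by (simp add: fibred_system_def)
    then have "(\<lambda>x. \<integral>\<^sup>+ g. indicator B g \<partial>\<Lambda> x) \<in> borel_measurable \<kappa>"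
      by (simp cong: measurable_cong_sets add: measurable_cong_sets[OF \<kappa> refl])
    then show ?thesis
      by (rule measurable_cong[THEN iffD1, rotated]) (use sL sp B in auto)
  qed
  show ?thesis
    unfolding star_measure_def
  proof (rule emeasure_measure_of_sigma[OF sets.sigma_algebra_axioms _ _ A])
    show "positive (sets M) (\<lambda>A. \<integral>\<^sup>+ x. emeasure (\<Lambda> x) A \<partial>\<kappa>)"
      by (simp add: positive_def)
    show "countably_additive (sets M) (\<lambda>A. \<integral>\<^sup>+ x. emeasure (\<Lambda> x) A \<partial>\<kappa>)"
    proof (rule countably_additiveI)
      fix F :: "nat \<Rightarrow> _"
      assume F: "range F \<subseteq> sets M" "disjoint_family F"
      have "(\<Sum>i. \<integral>\<^sup>+ x. emeasure (\<Lambda> x) (F i) \<partial>\<kappa>) = (\<integral>\<^sup>+ x. (\<Sum>i. emeasure (\<Lambda> x) (F i)) \<partial>\<kappa>)"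
        by (rule nn_integral_suminf[symmetric]) (use F meas in auto)
      also have "\<dots> = (\<integral>\<^sup>+ x. emeasure (\<Lambda> x) (\<Union>i. F i) \<partial>\<kappa>)"
        by (rule nn_integral_cong) (use F sL sp in \<open>auto intro!: suminf_emeasure\<close>)
      finally show "(\<Sum>i. \<integral>\<^sup>+ x. emeasure (\<Lambda> x) (F i) \<partial>\<kappa>) = (\<integral>\<^sup>+ x. emeasure (\<Lambda> x) (\<Union>i. F i) \<partial>\<kappa>)" .
    qed
  qed
qed


section \<open>Equivariant transition operators\<close>

text \<open>
  A transition operator is given by its transition probabilities \<open>g \<mapsto> P g\<close>, a Markov kernel on
  \<open>M\<close>; it acts on probability measures by \<open>\<alpha> \<mapsto> \<alpha> \<bind> P\<close>.
\<close>

definition equivariant_transition_operator ::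
    "('x, 'g) groupoid_data \<Rightarrow> 'g measure \<Rightarrow> ('g \<Rightarrow> 'g measure) \<Rightarrow> bool" where
  "equivariant_transition_operator G M P \<longleftrightarrow>
     P \<in> M \<rightarrow>\<^sub>M prob_algebra M \<and>
     (\<forall>g\<in>Mor G. emeasure (P g) (target_fibre G (tgt G g)) = 1) \<and>
     (\<forall>(g, h)\<in>composable G. P (cmp G g h) = left_translate G M g (P h))"

text \<open>The transition probabilities of the product \<open>Q P\<close>, characterised by \<open>\<alpha>(QP) = (\<alpha>Q)P\<close>.\<close>

definition operator_product ::
    "('g \<Rightarrow> 'g measure) \<Rightarrow> ('g \<Rightarrow> 'g measure) \<Rightarrow> 'g \<Rightarrow> 'g measure" where
  "operator_product Q P = (\<lambda>g. Q g \<bind> P)"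

lemma bind_operator_product:
  assumes "sets \<alpha> = sets M" "Q \<in> M \<rightarrow>\<^sub>M prob_algebra M" "P \<in> M \<rightarrow>\<^sub>M prob_algebra M"
  shows "\<alpha> \<bind> operator_product Q P = (\<alpha> \<bind> Q) \<bind> P"
proof -
  have "Q \<in> \<alpha> \<rightarrow>\<^sub>M subprob_algebra M"
    using measurable_prob_algebraD[OF assms(2)] by (simp add: measurable_cong_sets[OF assms(1) refl])
  then show ?thesis
    unfolding operator_product_def by (rule bind_assoc[symmetric, OF _ measurable_prob_algebraD[OF assms(3)]])
qed

lemma (in measurable_groupoid) equivariant_operator_product:
  assumes Q: "equivariant_transition_operator G M Q" and P: "equivariant_transition_operator G M P"
  shows "equivariant_transition_operator G M (operator_product Q P)"
proof -
  have Qm: "Q \<in> M \<rightarrow>\<^sub>M prob_algebra M" and Pm: "P \<in> M \<rightarrow>\<^sub>M prob_algebra M"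
    using P Q by (auto simp: equivariant_transition_operator_def)
  have QF: "emeasure (Q g) (target_fibre G (tgt G g)) = 1"
    and PF: "emeasure (P g) (target_fibre G (tgt G g)) = 1" if "g \<in> Mor G" for g
    using P Q that by (auto simp: equivariant_transition_operator_def)
  have setsQ: "sets (Q g) = sets M" and probQ: "prob_space (Q g)"
    and setsP: "sets (P g) = sets M" and probP: "prob_space (P g)" if "g \<in> Mor G" for g
    using measurable_space[OF Qm, of g] measurable_space[OF Pm, of g] that
    by (auto simp: space_M space_prob_algebra)
  have fibre: "target_fibre G x \<in> sets M" if "x \<in> Obj G" for x
  proof -
    have "target_fibre G x \<in> sets (P (ident G x))"
      using PF[OF ident_closed[OF that]] that emeasure_notin_sets[of "target_fibre G x" "P (ident G x)"]
      by (auto simp: tgt_ident)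
    then show ?thesis using setsP[OF ident_closed[OF that]] by simp
  qed
  have PmQ: "P \<in> Q g \<rightarrow>\<^sub>M subprob_algebra M" if "g \<in> Mor G" for g
    using measurable_prob_algebraD[OF Pm] by (simp add: measurable_cong_sets[OF setsQ[OF that] refl])
  have ne: "space (Q g) \<noteq> {}" if "g \<in> Mor G" for g
    using prob_space.not_empty[OF probQ[OF that]] .
  have prod: "emeasure (operator_product Q P g) A = (\<integral>\<^sup>+ k. emeasure (P k) A \<partial>Q g)"
    if "g \<in> Mor G" "A \<in> sets M" for g A
    unfolding operator_product_def using emeasure_bind[OF ne PmQ] that by blast
  have AEQ: "AE k in Q g. k \<in> target_fibre G (tgt G g)" if g: "g \<in> Mor G" for g
    using prob_space.AE_prob_1[OF probQ[OF g]] QF[OF g] by (auto simp: measure_def)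
  have meas_prod: "operator_product Q P \<in> M \<rightarrow>\<^sub>M prob_algebra M"
    unfolding operator_product_def
    by (rule measurable_bind_prob_space2[OF Qm]) (use Pm in simp)
  have sets_prod: "sets (operator_product Q P g) = sets M" if "g \<in> Mor G" for g
    using measurable_space[OF meas_prod, of g] that by (simp add: space_M space_prob_algebra)
  have cmpm: "cmp G g \<in> restrict_space M (target_fibre G (src G g)) \<rightarrow>\<^sub>M M" if g: "g \<in> Mor G" for g
  proof -
    have "Pair g \<in> restrict_space M (target_fibre G (src G g)) \<rightarrow>\<^sub>M restrict_space (M \<Otimes>\<^sub>M M) (composable G)"
      by (rule measurable_restrict_space2)
        (use g in \<open>auto simp: composable_def target_fibre_def space_restrict_space space_M
            intro!: measurable_restrict_space1 measurable_Pair1'\<close>)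
    from measurable_compose[OF this cmp_measurable] show ?thesis by simp
  qed
  have pre: "cmp G g -` A \<inter> target_fibre G (src G g) \<in> sets M"
    if g: "g \<in> Mor G" and A: "A \<in> sets M" for g A
  proof -
    have F: "target_fibre G (src G g) \<inter> space M \<in> sets M" using fibre src_closed g by auto
    have s: "space (restrict_space M (target_fibre G (src G g))) = target_fibre G (src G g)"
      by (auto simp: space_restrict_space space_M target_fibre_def)
    show ?thesis
      using measurable_sets[OF cmpm[OF g] A] unfolding s sets_restrict_space_iff[OF F] by auto
  qed
  have tr: "emeasure (left_translate G M g \<alpha>) A = emeasure \<alpha> (cmp G g -` A \<inter> target_fibre G (src G g))"
    if g: "g \<in> Mor G" and A: "A \<in> sets M" and \<alpha>: "sets \<alpha> = sets M" for g A \<alpha>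
  proof -
    have sp: "space \<alpha> = space M" using sets_eq_imp_space_eq[OF \<alpha>] .
    have s: "space (restrict_space \<alpha> (target_fibre G (src G g))) = target_fibre G (src G g)"
      by (auto simp: space_restrict_space sp space_M target_fibre_def)
    have sR: "sets (restrict_space \<alpha> (target_fibre G (src G g))) =
        sets (restrict_space M (target_fibre G (src G g)))"
      by (simp add: sets_restrict_space \<alpha>)
    have m: "cmp G g \<in> restrict_space \<alpha> (target_fibre G (src G g)) \<rightarrow>\<^sub>M M"
      using cmpm[OF g] by (simp add: measurable_cong_sets[OF sR refl])
    show ?thesis
      unfolding left_translate_def emeasure_distr[OF m A] s
      by (rule emeasure_restrict_space) (use fibre[OF src_closed[OF g]] \<alpha> in auto)
  qed
  show ?thesis
    unfolding equivariant_transition_operator_def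
  proof (intro conjI ballI meas_prod)
    fix g assume g: "g \<in> Mor G"
    have "emeasure (operator_product Q P g) (target_fibre G (tgt G g)) =
        (\<integral>\<^sup>+ k. emeasure (P k) (target_fibre G (tgt G g)) \<partial>Q g)"
      using prod g fibre tgt_closed by blast
    also have "\<dots> = (\<integral>\<^sup>+ k. 1 \<partial>Q g)"
    proof (rule nn_integral_cong_AE, use AEQ[OF g] in eventually_elim)
      fix k assume "k \<in> target_fibre G (tgt G g)"
      then have "k \<in> Mor G" "tgt G k = tgt G g" by (auto simp: target_fibre_def)
      then show "emeasure (P k) (target_fibre G (tgt G g)) = 1" using PF[of k] by simp
    qed
    also have "\<dots> = 1" using prob_space.emeasure_space_1[OF probQ[OF g]] by simp
    finally show "emeasure (operator_product Q P g) (target_fibre G (tgt G g)) = 1" .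
  next
    fix p assume "p \<in> composable G"
    then obtain g h where p: "p = (g, h)" and g: "g \<in> Mor G" and h: "h \<in> Mor G" and gh: "src G g = tgt G h"
      by (auto simp: composable_def)
    note c = cmp_closed[OF g h gh]
    have eqv: "P (cmp G g k) = left_translate G M g (P k)" "Q (cmp G g k) = left_translate G M g (Q k)"
      if "k \<in> target_fibre G (src G g)" for k
      using P Q that g by (auto simp: equivariant_transition_operator_def composable_def target_fibre_def)
    have "operator_product Q P (cmp G g h) = left_translate G M g (operator_product Q P h)"
    proof (rule measure_eqI)
      show "sets (operator_product Q P (cmp G g h)) = sets (left_translate G M g (operator_product Q P h))"
        by (simp add: sets_prod[OF c] left_translate_def)
      fix A assume "A \<in> sets (operator_product Q P (cmp G g h))"
      then have A: "A \<in> sets M" by (simp add: sets_prod[OF c])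
      let ?F = "target_fibre G (src G g)"
      let ?R = "restrict_space (Q h) ?F"
      have sR: "sets ?R = sets (restrict_space M ?F)"
        by (simp add: sets_restrict_space setsQ[OF h])
      have F: "?F \<inter> space (Q h) \<in> sets (Q h)"
        using fibre[OF src_closed[OF g]] setsQ[OF h] by auto
      have m: "cmp G g \<in> ?R \<rightarrow>\<^sub>M M"
        using cmpm[OF g] by (simp add: measurable_cong_sets[OF sR refl])
      have mP: "(\<lambda>k. emeasure (P k) A) \<in> borel_measurable M"
        using measurable_compose[OF measurable_prob_algebraD[OF Pm] measurable_emeasure_subprob_algebra[OF A]]
        by simp
      have hF: "h \<in> ?F" using h gh by (simp add: target_fibre_def)
      have "emeasure (operator_product Q P (cmp G g h)) A = (\<integral>\<^sup>+ k. emeasure (P k) A \<partial>distr ?R M (cmp G g))"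
        using prod[OF c A] eqv(2)[OF hF] by (simp add: left_translate_def)
      also have "\<dots> = (\<integral>\<^sup>+ k. emeasure (P (cmp G g k)) A \<partial>?R)"
        by (rule nn_integral_distr[OF m]) (use mP in simp)
      also have "\<dots> = (\<integral>\<^sup>+ k. emeasure (P (cmp G g k)) A * indicator ?F k \<partial>Q h)"
        by (rule nn_integral_restrict_space[OF F])
      also have "\<dots> = (\<integral>\<^sup>+ k. emeasure (P k) (cmp G g -` A \<inter> ?F) \<partial>Q h)"
      proof (rule nn_integral_cong_AE, use AEQ[OF h] in eventually_elim)
        fix k assume "k \<in> target_fibre G (tgt G h)"
        then have k: "k \<in> ?F" "k \<in> Mor G" using gh by (auto simp: target_fibre_def)
        show "emeasure (P (cmp G g k)) A * indicator ?F k = emeasure (P k) (cmp G g -` A \<inter> ?F)"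
          using k tr[OF g A setsP[OF k(2)]] eqv(1)[OF k(1)] by simp
      qed
      also have "\<dots> = emeasure (operator_product Q P h) (cmp G g -` A \<inter> ?F)"
        using prod[OF h pre[OF g A]] by simp
      also have "\<dots> = emeasure (left_translate G M g (operator_product Q P h)) A"
        using tr[OF g A sets_prod[OF h]] by simp
      finally show "emeasure (operator_product Q P (cmp G g h)) A =
          emeasure (left_translate G M g (operator_product Q P h)) A" .
    qed
    then show "case p of (g, h) \<Rightarrow> operator_product Q P (cmp G g h) =
        left_translate G M g (operator_product Q P h)"
      by (simp add: p)
  qed
qed

definition absolutely_continuous_transitions ::
    "('x, 'g) groupoid_data \<Rightarrow> ('x \<Rightarrow> 'g measure) \<Rightarrow> ('g \<Rightarrow> 'g measure) \<Rightarrow> bool" where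
  "absolutely_continuous_transitions G \<Lambda> P \<longleftrightarrow>
     (\<forall>g\<in>Mor G. absolutely_continuous (\<Lambda> (tgt G g)) (P g))"


section \<open>Discrepancy and integral strong asymptotic invariance\<close>

definition total_variation_norm :: "'a measure \<Rightarrow> ('a set \<Rightarrow> real) \<Rightarrow> ennreal" where
  "total_variation_norm M \<theta> =
     (SUP \<A> \<in> {\<A>. finite \<A> \<and> \<A> \<subseteq> sets M \<and> partition_on (space M) \<A>}. \<Sum>A\<in>\<A>. ennreal \<bar>\<theta> A\<bar>)"

definition discrepancy ::
    "('x, 'g) groupoid_data \<Rightarrow> 'g measure \<Rightarrow> ('g \<Rightarrow> 'g measure) \<Rightarrow> 'g \<Rightarrow> ennreal" where
  "discrepancy G M P g =
     total_variation_norm M (\<lambda>A. measure (P g) A - measure (P (ident G (tgt G g))) A)"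

text \<open>
  The first conjunct says that the discrepancy functions, which are bounded by 2, are elements of
  \<open>L\<^sup>\<infinity>\<close> of the star measure. As for any such space of classes of functions modulo negligible sets,
  measurability is with respect to the completed \<open>\<sigma>\<close>-algebra; the integral over \<open>m\<close> agrees
  with the one over its completion.
\<close>

definition isai ::
    "('x, 'g) groupoid_data \<Rightarrow> 'g measure \<Rightarrow> ('x \<Rightarrow> 'g measure) \<Rightarrow> 'x measure \<Rightarrow>
      (nat \<Rightarrow> 'g \<Rightarrow> 'g measure) \<Rightarrow> bool" where
  "isai G M \<Lambda> \<kappa> P \<longleftrightarrow>
     (\<forall>n. discrepancy G M (P n) \<in> borel_measurable (completion (star_measure M \<Lambda> \<kappa>))) \<and>
     (\<forall>m. prob_space m \<longrightarrow> sets m = sets M \<longrightarrow> absolutely_continuous (star_measure M \<Lambda> \<kappa>) m \<longrightarrow>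
        (\<lambda>n. \<integral>\<^sup>+ g. discrepancy G M (P n) g \<partial>m) \<longlonglongrightarrow> 0)"

end

theory Submission
  imports Defs
begin

text \<open>
  Write \<open>x\<close> for the identity at the target of \<open>g\<close>. Since \<open>Q g\<close> and \<open>Q x\<close> both live on the
  target fibre of \<open>g\<close>, subtracting \<open>P x\<close> from all transition probabilities of \<open>P\<close> on this fibre
  bounds the discrepancy of \<open>QP\<close> at \<open>g\<close> by the sum of the integrals of the discrepancy of \<open>P\<close>
  against \<open>Q g\<close> and \<open>Q x\<close>. Integrating over \<open>m\<close> gives the integrals of the discrepancy of \<open>P\<close>
  against two probability measures, which are absolutely continuous: a negligible set is
  \<open>\<lambda>\<^sup>y\<close>-negligible for almost every object \<open>y\<close>, hence \<open>Q\<close>-negligible from almost every \<open>g\<close>.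

  The discrepancy of \<open>QP\<close> must also be measurable modulo negligible sets. Here the
  Lebesgue--Rokhlin hypothesis enters: by a Lusin argument, a single injective function into the
  reals provides countably many sets that approximate every measurable set simultaneously for the
  relevant measures.
\<close>

section \<open>Compact approximation, Lusin separation, and their transport along Rokhlin
  isomorphisms\<close>

section \<open>Approximation in Lebesgue--Rokhlin spaces\<close>

text \<open>A completion-measurable set is a Borel set \<open>S\<close> up to a piece of a null set,
  and inner regularity of a finite Borel measure yields the compact set already inside
  \<open>S\<close>.\<close>

lemma completion_inner_compact:
  fixes \<nu> :: "'a::{second_countable_topology, complete_space} measure"
  assumes sb: "sets \<nu> = sets borel" and fin: "emeasure \<nu> (space \<nu>) \<noteq> \<infinity>"
    and X: "X \<in> sets (completion \<nu>)" and e: "e > 0"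
  obtains K where "compact K" "K \<subseteq> X" "emeasure (completion \<nu>) (X - K) \<le> ennreal e"
proof -
  obtain S N N' where S: "X = S \<union> N" "N \<subseteq> N'" "N' \<in> null_sets \<nu>" "S \<in> sets \<nu>"
    using sets_completionE[OF X] by metis
  interpret finite_measure \<nu> by (rule finite_measureI) (rule fin)
  have S_sup: "emeasure \<nu> S = (SUP K \<in> {K. K \<subseteq> S \<and> compact K}. emeasure \<nu> K)"
    by (rule inner_regular[OF sb fin]) (use S sb in auto)
  obtain K where K: "K \<subseteq> S" "compact K" "emeasure \<nu> (S - K) \<le> ennreal e"
  \<comment> \<open>Only in the second case is \<open>measure \<nu> S - e\<close> a positive real
    below the supremum; in the first case the empty set suffices.\<close>
  proof (cases "emeasure \<nu> S \<le> ennreal e")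
    case True
    then show thesis using that[of "{}"] by auto
  next
    case False
    then have Se: "measure \<nu> S > e" using e by (simp add: emeasure_eq_measure)
    then have "ennreal (measure \<nu> S - e) < emeasure \<nu> S"
      using e by (simp add: emeasure_eq_measure ennreal_less_iff)
    also note S_sup
    finally obtain K where K: "K \<subseteq> S" "compact K" "ennreal (measure \<nu> S - e) < emeasure \<nu> K"
      unfolding less_SUP_iff by blast
    have Ks: "K \<in> sets \<nu>" using K sb by (auto intro: borel_closed compact_imp_closed)
    have "measure \<nu> (S - K) = measure \<nu> S - measure \<nu> K"
      using K S Ks by (intro finite_measure_Diff) auto
    also have "\<dots> \<le> e"
      using K(3) Se by (simp add: emeasure_eq_measure ennreal_less_iff)
    finally have "emeasure \<nu> (S - K) \<le> ennreal e" using e by (simp add: emeasure_eq_measure)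
    then show thesis using that K by blast
  qed
  have "emeasure (completion \<nu>) (X - K) \<le> emeasure (completion \<nu>) ((S - K) \<union> N')"
    using S K sb by (intro emeasure_mono)
      (auto intro!: sets_completionI_sets sets.Un sets.Diff borel_closed compact_imp_closed)
  also have "\<dots> = emeasure \<nu> ((S - K) \<union> N')"
  proof -
    have "(S - K) \<union> N' \<in> sets \<nu>"
      using S K sb by (intro sets.Un sets.Diff) (auto intro: borel_closed compact_imp_closed)
    then show ?thesis by simp
  qed
  also have "\<dots> = emeasure \<nu> (S - K)"
    using S K sb by (intro emeasure_Un_null_set) (auto intro: borel_closed compact_imp_closed)
  finally have "emeasure (completion \<nu>) (X - K) \<le> ennreal e" using K by simp
  then show thesis using that[of K] K S by blast
qed

text \<open>Lusin's theorem with an extra set: on a compact set of almost full measure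
  \<open>h\<close> is continuous and \<open>X\<close> is relatively clopen. The two pieces then have
  disjoint compact images by injectivity, and compactness of the first image selects finitely many
  basic open sets that miss the second.\<close>

lemma lusin_separation:
  fixes \<nu> :: "'a::{second_countable_topology, complete_space} measure"
    and h :: "'a \<Rightarrow> 'b::t2_space"
  assumes sb: "sets \<nu> = sets borel" and fin: "emeasure \<nu> (space \<nu>) \<noteq> \<infinity>"
    and b: "\<And>n::nat. open (b n)" "\<And>S. open S \<Longrightarrow> \<exists>k. S = \<Union>{b n |n. n \<in> k}"
    and T: "T \<in> sets (completion \<nu>)"
    and h: "\<And>n. {x\<in>T. h x \<in> b n} \<in> sets (completion \<nu>)" and inj: "inj_on h T"
    and X: "X \<in> sets (completion \<nu>)" "X \<subseteq> T" and e: "e > 0"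
  obtains C D F where "C \<subseteq> X" "D \<subseteq> T - X" "C \<in> sets (completion \<nu>)" "D \<in> sets (completion \<nu>)"
    "emeasure (completion \<nu>) (T - (C \<union> D)) \<le> ennreal e"
    "finite F" "h ` C \<subseteq> (\<Union>n\<in>F. b n)" "h ` D \<inter> (\<Union>n\<in>F. b n) = {}"
proof -
  \<comment> \<open>Index 0 is reserved for \<open>X\<close>, so that the intersection
    \<open>W\<close> below is split by \<open>X\<close> as well as by every preimage of a basic open
    set.\<close>
  define Z where "Z n = (case n of 0 \<Rightarrow> X | Suc m \<Rightarrow> {x\<in>T. h x \<in> b m})" for n
  \<comment> \<open>The factor 1/2 pays for the two errors at each \<open>n\<close>, one inside
    \<open>Z n\<close> and one inside its complement in \<open>T\<close>; all errors then sum to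
    \<open>e\<close>.\<close>
  define \<delta> where "\<delta> n = e / 2 * (1/2) ^ Suc n" for n :: nat
  have \<delta>: "\<delta> n > 0" for n using e by (simp add: \<delta>_def)
  have ZT: "Z n \<subseteq> T" and Zs: "Z n \<in> sets (completion \<nu>)" for n
    using X h by (auto simp: Z_def split: nat.splits)
  have "\<exists>K. compact K \<and> K \<subseteq> Z n \<and> emeasure (completion \<nu>) (Z n - K) \<le> ennreal (\<delta> n)" for n
    using completion_inner_compact[OF sb fin Zs \<delta>] by metis
  then obtain K where K: "\<And>n. compact (K n)" "\<And>n. K n \<subseteq> Z n"
      "\<And>n. emeasure (completion \<nu>) (Z n - K n) \<le> ennreal (\<delta> n)"
    by metis
  have "\<exists>K. compact K \<and> K \<subseteq> T - Z n \<and> emeasure (completion \<nu>) ((T - Z n) - K) \<le> ennreal (\<delta> n)" for n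
    using completion_inner_compact[OF sb fin sets.Diff[OF T Zs] \<delta>] by metis
  then obtain L where L: "\<And>n. compact (L n)" "\<And>n. L n \<subseteq> T - Z n"
      "\<And>n. emeasure (completion \<nu>) ((T - Z n) - L n) \<le> ennreal (\<delta> n)"
    by metis
  have cs: "C \<in> sets (completion \<nu>)" if "compact C" for C
    using that by (auto simp: sb intro!: sets_completionI_sets borel_closed compact_imp_closed)
  txt \<open>On the compact set \<open>W\<close> each preimage of \<open>b n\<close> is relatively clopen, so \<open>h\<close> is continuous there.\<close>
  define W where "W = (\<Inter>n. K n \<union> L n)"
  have W: "compact W"
  proof -
    \<comment> \<open>\<open>W\<close> is a closed subset of a single compact set.\<close>
    have "W = (K 0 \<union> L 0) \<inter> W" unfolding W_def by blast
    moreover have "closed W"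
      unfolding W_def using K(1) L(1) compact_imp_closed by (intro closed_INT) auto
    ultimately show ?thesis using K(1)[of 0] L(1)[of 0] by (metis compact_Int_closed compact_Un)
  qed
  have WT: "W \<subseteq> T" using K(2)[of 0] L(2)[of 0] ZT[of 0] unfolding W_def by blast
  have cont: "continuous_on W h"
  proof (subst continuous_on_open_gen[where T=UNIV], simp, intro allI impI)
    fix U :: "'b set" assume "openin (top_of_set UNIV) U"
    then have "open U" by simp
    then obtain k where k: "U = \<Union>{b n |n. n \<in> k}" using b(2) by blast
    have *: "x \<in> L (Suc n) \<longleftrightarrow> h x \<notin> b n" if "x \<in> W" for x n
    proof -
      have "x \<in> T" "x \<in> K (Suc n) \<union> L (Suc n)" using that WT by (auto simp: W_def)
      with K(2)[of "Suc n"] L(2)[of "Suc n"] show ?thesis by (auto simp: Z_def)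
    qed
    have "W \<inter> h -` U = W \<inter> (\<Union>n\<in>k. - L (Suc n))"
      unfolding k by (auto simp: *) blast
    moreover have "open (\<Union>n\<in>k. - L (Suc n))"
      using L(1) compact_imp_closed by (intro open_UN) auto
    ultimately show "openin (top_of_set W) (W \<inter> h -` U)"
      by (metis openin_open_Int)
  qed
  define C where "C = W \<inter> K 0"
  define D where "D = W \<inter> L 0"
  have CD: "compact C" "compact D" "C \<subseteq> X" "D \<subseteq> T - X"
    using W K(1)[of 0] L(1)[of 0] K(2)[of 0] L(2)[of 0]
    by (auto simp: C_def D_def Z_def intro: compact_Int)
  have hC: "compact (h ` C)" and hD: "compact (h ` D)"
    using CD(1,2) by (auto intro!: compact_continuous_image continuous_on_subset[OF cont] simp: C_def D_def)
  have disj: "h ` C \<inter> h ` D = {}"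
  proof -
    have False if "x \<in> C" "y \<in> D" "h x = h y" for x y
      using that CD(3,4) X(2) inj_onD[OF inj that(3)] by auto
    then show ?thesis by blast
  qed
  \<comment> \<open>The complement of \<open>h\<close> D\<open>is an open neighbourhood of\<close>h
    \<open>C\<close>; it is a union of basic sets, and these are the cover to which compactness is
    applied.\<close>
  have "open (- h ` D)" using compact_imp_closed[OF hD] by auto
  then obtain k where "- h ` D = \<Union>{b n |n. n \<in> k}" using b(2) by blast
  then have k: "- h ` D = (\<Union>n\<in>k. b n)" by (simp add: Setcompr_eq_image)
  have "h ` C \<subseteq> (\<Union>n\<in>k. b n)" unfolding k[symmetric] using disj by blast
  then obtain F where F: "F \<subseteq> k" "finite F" "h ` C \<subseteq> (\<Union>n\<in>F. b n)"
    by (rule compactE_image[OF hC b(1)])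
  have hDF: "h ` D \<inter> (\<Union>n\<in>F. b n) = {}"
  proof -
    have "(\<Union>n\<in>F. b n) \<subseteq> - h ` D" unfolding k using F(1) by blast
    then show ?thesis by blast
  qed
  have mC: "C \<in> sets (completion \<nu>)" "D \<in> sets (completion \<nu>)" using cs CD by auto
  let ?B = "\<lambda>n. (Z n - K n) \<union> (T - Z n - L n)"
  have Bs: "?B n \<in> sets (completion \<nu>)" for n
    using Zs T cs[OF K(1)] cs[OF L(1)] by (intro sets.Un sets.Diff)
  \<comment> \<open>A point in all the sets \<open>K n \<union> L n\<close> lies in \<open>W\<close>
    and in \<open>K 0\<close> or \<open>L 0\<close>, hence in \<open>C\<close> or \<open>D\<close>.
    A point left over therefore fails at some index.\<close>
  have sub: "T - (C \<union> D) \<subseteq> (\<Union>n. ?B n)"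
  proof
    fix x assume x: "x \<in> T - (C \<union> D)"
    then obtain n where "x \<notin> K n \<union> L n" unfolding C_def D_def W_def by auto
    then have "x \<in> ?B n" using x by auto
    then show "x \<in> (\<Union>n. ?B n)" by blast
  qed
  have "emeasure (completion \<nu>) (T - (C \<union> D)) \<le> emeasure (completion \<nu>) (\<Union>n. ?B n)"
    using Bs sub by (intro emeasure_mono) auto
  also have "\<dots> \<le> (\<Sum>n. emeasure (completion \<nu>) (?B n))"
    using Bs by (intro emeasure_subadditive_countably) auto
  also have "\<dots> \<le> (\<Sum>n. ennreal (e * (1/2) ^ Suc n))"
  proof (rule suminf_le)
    fix n
    have "emeasure (completion \<nu>) (?B n) \<le>
        emeasure (completion \<nu>) (Z n - K n) + emeasure (completion \<nu>) (T - Z n - L n)"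
      using Zs T cs[OF K(1)] cs[OF L(1)] by (intro emeasure_subadditive sets.Diff)
    also have "\<dots> \<le> ennreal (\<delta> n) + ennreal (\<delta> n)" using K(3) L(3) by (intro add_mono)
    also have "\<dots> = ennreal (e * (1/2) ^ Suc n)"
      using e by (simp add: \<delta>_def flip: ennreal_plus)
    finally show "emeasure (completion \<nu>) (?B n) \<le> ennreal (e * (1/2) ^ Suc n)" .
  qed auto
  also have "\<dots> = ennreal e"
    using sums_mult[OF power_half_series, of e] e
    by (subst suminf_ennreal2) (auto simp: sums_iff)
  finally have "emeasure (completion \<nu>) (T - (C \<union> D)) \<le> ennreal e" .
  then show thesis using that CD(3,4) mC F(2,3) hDF by blast
qed

text \<open>Besides unpacking the isomorphism, this transfers finiteness to the model measure:
  \<open>T\<close> is conull there and has the same mass as \<open>S\<close>. Finiteness is what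
  makes inner regularity available.\<close>

lemma lebesgue_rokhlinE:
  fixes \<eta> :: "'a measure"
  assumes "lebesgue_rokhlin \<eta>" and fin: "finite_measure \<eta>"
  obtains \<nu> :: "real measure" and f S T where
    "sets \<nu> = sets borel" "emeasure \<nu> (space \<nu>) \<noteq> \<infinity>"
    "S \<subseteq> space \<eta>" "space \<eta> - S \<in> null_sets (completion \<eta>)" "S \<in> sets (completion \<eta>)"
    "T \<in> sets (completion \<nu>)" "bij_betw f S T"
    "\<And>A. A \<subseteq> S \<Longrightarrow> A \<in> sets (completion \<eta>) \<longleftrightarrow> f ` A \<in> sets (completion \<nu>)"
    "\<And>A. A \<subseteq> S \<Longrightarrow> A \<in> sets (completion \<eta>) \<Longrightarrow>
        emeasure (completion \<eta>) A = emeasure (completion \<nu>) (f ` A)"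
proof -
  obtain \<nu> f S T where nu: "sets \<nu> = sets (borel :: real measure)"
    and S: "S \<subseteq> space \<eta>" "space \<eta> - S \<in> null_sets (completion \<eta>)"
    and T: "T \<subseteq> space \<nu>" "space \<nu> - T \<in> null_sets (completion \<nu>)"
    and bij: "bij_betw f S T"
    and iff: "\<And>A. A \<subseteq> S \<Longrightarrow> A \<in> sets (completion \<eta>) \<longleftrightarrow> f ` A \<in> sets (completion \<nu>)"
    and eq: "\<And>A. A \<subseteq> S \<Longrightarrow> A \<in> sets (completion \<eta>) \<Longrightarrow>
        emeasure (completion \<eta>) A = emeasure (completion \<nu>) (f ` A)"
    using assms(1) unfolding lebesgue_rokhlin_def isomorphic_mod_0_def rokhlin_model_def by meson
  have Ss: "S \<in> sets (completion \<eta>)"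
    using sets.compl_sets[of "space \<eta> - S" "completion \<eta>"] S by (auto simp: double_diff)
  have Ts: "T \<in> sets (completion \<nu>)"
    using sets.compl_sets[of "space \<nu> - T" "completion \<nu>"] T by (auto simp: double_diff)
  have "emeasure \<nu> (space \<nu>) = emeasure (completion \<nu>) (T \<union> (space \<nu> - T))"
    using T by (simp add: Un_absorb1)
  also have "\<dots> = emeasure (completion \<nu>) (f ` S)"
    using bij emeasure_Un_null_set[OF Ts T(2)] by (simp add: bij_betw_def)
  also have "\<dots> = emeasure (completion \<eta>) S" using eq[OF _ Ss] by simp
  also have "\<dots> < \<infinity>"
    using finite_measure.emeasure_finite[OF fin] Ss
    by (simp add: less_top[symmetric] emeasure_completion[OF Ss])
  finally have fin_nu: "emeasure \<nu> (space \<nu>) \<noteq> \<infinity>" by simp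
  show thesis by (rule that[OF nu fin_nu S Ss Ts bij iff eq])
qed

text \<open>The function \<open>h\<close> is unrelated to the isomorphism provided by the Rokhlin
  structure of \<open>\<eta>\<close>. Hence one \<open>h\<close> can serve many measures
  \<open>\<eta>\<close>, and the approximating sets are always drawn from the same countable family
  of preimages of finite unions of basic sets.\<close>

lemma rokhlin_approximation:
  fixes \<eta> :: "'a measure" and h :: "'a \<Rightarrow> 'b::t2_space"
  assumes rok: "lebesgue_rokhlin \<eta>" and fin: "finite_measure \<eta>"
    and b: "\<And>n::nat. open (b n)" "\<And>S. open S \<Longrightarrow> \<exists>k. S = \<Union>{b n |n. n \<in> k}"
    and h: "h \<in> borel_measurable \<eta>" and S: "S \<in> sets \<eta>" "emeasure \<eta> (space \<eta> - S) = 0"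
    and inj: "inj_on h S" and A: "A \<in> sets \<eta>" and e: "e > 0"
  obtains F where "finite F"
    "emeasure \<eta> (sym_diff A {x\<in>space \<eta>. h x \<in> (\<Union>n\<in>F. b n)}) \<le> ennreal e"
proof -
  obtain \<nu> :: "real measure" and f S1 T1 where
    nu: "sets \<nu> = sets borel" "emeasure \<nu> (space \<nu>) \<noteq> \<infinity>"
    and S1: "S1 \<subseteq> space \<eta>" "space \<eta> - S1 \<in> null_sets (completion \<eta>)" "S1 \<in> sets (completion \<eta>)"
    and T1: "T1 \<in> sets (completion \<nu>)" and bij: "bij_betw f S1 T1"
    and iff: "\<And>A. A \<subseteq> S1 \<Longrightarrow> A \<in> sets (completion \<eta>) \<longleftrightarrow> f ` A \<in> sets (completion \<nu>)"
    and eq: "\<And>A. A \<subseteq> S1 \<Longrightarrow> A \<in> sets (completion \<eta>) \<Longrightarrow>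
        emeasure (completion \<eta>) A = emeasure (completion \<nu>) (f ` A)"
    by (rule lebesgue_rokhlinE[OF rok fin], rule that)
  define D where "D = S \<inter> S1"
  have Ds: "D \<in> sets (completion \<eta>)" and DS: "D \<subseteq> S1" "D \<subseteq> S"
    using S S1 by (auto simp: D_def)
  have injf: "inj_on f D" using bij DS by (auto simp: bij_betw_def intro: inj_on_subset)
  define g where "g = inv_into D f"
  have gf: "g (f x) = x" if "x \<in> D" for x using injf that by (simp add: g_def)
  have img: "f ` A \<in> sets (completion \<nu>)" if "A \<subseteq> D" "A \<in> sets (completion \<eta>)" for A
    using iff[of A] that DS by blast
  \<comment> \<open>Isomorphism modulo 0 preserves measurability for the completions only, which is
    why the separation lemma is phrased for completion-measurable sets.\<close>
  have hn: "{x\<in>f ` D. h (g x) \<in> b n} \<in> sets (completion \<nu>)" for n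
  proof -
    have "{x\<in>f ` D. h (g x) \<in> b n} = f ` (D \<inter> (h -` b n \<inter> space \<eta>))"
      using gf DS S1(1) by auto
    moreover have "h -` b n \<inter> space \<eta> \<in> sets \<eta>" using h b(1) by (auto intro: measurable_sets)
    ultimately show ?thesis using Ds by (auto intro!: img)
  qed
  have injh: "inj_on (\<lambda>x. h (g x)) (f ` D)"
    using inj_onD[OF inj] DS gf by (intro inj_onI) (metis imageE subsetD)
  have X: "f ` (A \<inter> D) \<in> sets (completion \<nu>)" "f ` (A \<inter> D) \<subseteq> f ` D"
    using Ds A by (auto intro!: img)
  obtain C E F where CE: "C \<subseteq> f ` (A \<inter> D)" "E \<subseteq> f ` D - f ` (A \<inter> D)"
      "C \<in> sets (completion \<nu>)" "E \<in> sets (completion \<nu>)"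
      "emeasure (completion \<nu>) (f ` D - (C \<union> E)) \<le> ennreal e"
      and F: "finite F" "(\<lambda>x. h (g x)) ` C \<subseteq> (\<Union>n\<in>F. b n)" "(\<lambda>x. h (g x)) ` E \<inter> (\<Union>n\<in>F. b n) = {}"
    by (rule lusin_separation[OF nu b img[OF order_refl Ds] hn injh X e])
  define R where "R = {x\<in>D. f x \<notin> C \<and> f x \<notin> E}"
  have fR: "f ` R = f ` D - (C \<union> E)" by (auto simp: R_def)
  have Rs: "R \<in> sets (completion \<eta>)"
    using iff[of R] fR CE(3,4) img[OF order_refl Ds] DS by (auto simp: R_def)
  have eR: "emeasure (completion \<eta>) R \<le> ennreal e"
      proof -
    have "R \<subseteq> S1" using DS by (auto simp: R_def)
    from eq[OF this Rs] show ?thesis using fR CE(5) by simp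
  qed
  have N: "space \<eta> - D \<in> null_sets (completion \<eta>)"
  proof -
    have "space \<eta> - S \<in> null_sets (completion \<eta>)"
      using S by (intro null_sets_completionI) auto
    then have "(space \<eta> - S) \<union> (space \<eta> - S1) \<in> null_sets (completion \<eta>)" using S1(2) by blast
    then show ?thesis by (simp add: D_def Diff_Int)
  qed
  let ?V = "{x\<in>space \<eta>. h x \<in> (\<Union>n\<in>F. b n)}"
  have V: "?V \<in> sets \<eta>"
  proof -
    have "?V = h -` (\<Union>n\<in>F. b n) \<inter> space \<eta>" by auto
    also have "\<dots> \<in> sets \<eta>" using h b(1) by (intro measurable_sets) auto
    finally show ?thesis .
  qed
  \<comment> \<open>On \<open>D\<close> outside \<open>R\<close> the separation decides correctly:
    points over \<open>C\<close> lie in both \<open>A\<close> and \<open>?V\<close>, points over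
    \<open>E\<close> in neither.\<close>
  have sub: "sym_diff A ?V \<subseteq> R \<union> (space \<eta> - D)"
  proof
    fix x assume x: "x \<in> sym_diff A ?V"
    have sp: "x \<in> space \<eta>" using x sets.sets_into_space[OF A] by auto
    have "x \<notin> D \<or> x \<in> R"
    proof (rule ccontr)
      assume "\<not> (x \<notin> D \<or> x \<in> R)"
      then have xD: "x \<in> D" and "f x \<in> C \<or> f x \<in> E" by (auto simp: R_def)
      then consider "f x \<in> C" | "f x \<in> E" by blast
      then show False
      proof cases
        case 1
        then have "f x \<in> f ` (A \<inter> D)" using CE(1) by blast
        then have "x \<in> A" using inj_onD[OF injf _ xD] by blast
        moreover have "h x \<in> (\<Union>n\<in>F. b n)" using F(2) 1 gf[OF xD] by force
        ultimately show False using x sp by simp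
      next
        case 2
        then have "x \<notin> A" using CE(2) xD by blast
        moreover have "h x \<notin> (\<Union>n\<in>F. b n)" using F(3) 2 gf[OF xD] by force
        ultimately show False using x by simp
      qed
    qed
    then show "x \<in> R \<union> (space \<eta> - D)" using sp by blast
  qed
  have "emeasure \<eta> (sym_diff A ?V) = emeasure (completion \<eta>) (sym_diff A ?V)"
    using A V by simp
  also have "\<dots> \<le> emeasure (completion \<eta>) (R \<union> (space \<eta> - D))"
    using Rs N sub by (intro emeasure_mono) auto
  also have "\<dots> = emeasure (completion \<eta>) R" by (rule emeasure_Un_null_set[OF Rs N])
  also note eR
  finally show thesis using that[OF F(1)] by blast
qed

text \<open>The isomorphism to the real line is itself injective. It is measurable for the
  completion, so changing it on a null set makes it measurable, and removing that null set keeps it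
  injective.\<close>

lemma rokhlin_injective_function:
  fixes \<eta> :: "'a measure"
  assumes rok: "lebesgue_rokhlin \<eta>" and fin: "finite_measure \<eta>"
  obtains h :: "'a \<Rightarrow> real" and S where "h \<in> borel_measurable \<eta>" "S \<in> sets \<eta>"
    "emeasure \<eta> (space \<eta> - S) = 0" "inj_on h S"
proof -
  obtain \<nu> :: "real measure" and f S1 T1 where
    nu: "sets \<nu> = sets borel" "emeasure \<nu> (space \<nu>) \<noteq> \<infinity>"
    and S1: "S1 \<subseteq> space \<eta>" "space \<eta> - S1 \<in> null_sets (completion \<eta>)" "S1 \<in> sets (completion \<eta>)"
    and T1: "T1 \<in> sets (completion \<nu>)" and bij: "bij_betw f S1 T1"
    and iff: "\<And>A. A \<subseteq> S1 \<Longrightarrow> A \<in> sets (completion \<eta>) \<longleftrightarrow> f ` A \<in> sets (completion \<nu>)"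
    by (rule lebesgue_rokhlinE[OF rok fin], rule that)
  \<comment> \<open>The value 0 off \<open>S1\<close> is arbitrary: it changes preimages at most by
    the complement of \<open>S1\<close>, a null set of the completion.\<close>
  define f0 where "f0 x = (if x \<in> S1 then f x else 0)" for x
  have "f0 \<in> borel_measurable (completion \<eta>)"
  proof (rule measurableI)
    fix B :: "real set" assume B: "B \<in> sets borel"
    have "f ` (S1 \<inter> f -` B) = T1 \<inter> B" using bij by (auto simp: bij_betw_def)
    moreover have "T1 \<inter> B \<in> sets (completion \<nu>)" using T1 B nu by auto
    ultimately have 1: "S1 \<inter> f -` B \<in> sets (completion \<eta>)" using iff[of "S1 \<inter> f -` B"] by auto
    have "f0 -` B \<inter> space (completion \<eta>) = (S1 \<inter> f -` B) \<union> (if 0 \<in> B then space \<eta> - S1 else {})"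
      using S1(1) by (auto simp: f0_def split: if_splits)
    then show "f0 -` B \<inter> space (completion \<eta>) \<in> sets (completion \<eta>)"
      using 1 S1(2) by auto
  qed auto
  then obtain h where h: "h \<in> borel_measurable \<eta>" "AE x in \<eta>. f0 x = h x"
    using completion_ex_borel_measurable_real by blast
  have "AE x in completion \<eta>. x \<in> S1"
    using S1 by (intro AE_I'[OF S1(2)]) auto
  then have "AE x in \<eta>. x \<in> S1" by (simp add: AE_completion_iff)
  with h(2) have "AE x in \<eta>. f0 x = h x \<and> x \<in> S1" by eventually_elim simp
  \<comment> \<open>\<open>N\<close> collects in one measurable null set the points where
    \<open>h\<close> differs from \<open>f0\<close> and those where the isomorphism is not
    defined.\<close>
  then obtain N where N: "{x\<in>space \<eta>. \<not> (f0 x = h x \<and> x \<in> S1)} \<subseteq> N" "N \<in> null_sets \<eta>"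
    unfolding eventually_ae_filter by blast
  show thesis
  proof (rule that[OF h(1)])
    show "space \<eta> - N \<in> sets \<eta>" using N by auto
    have "space \<eta> - (space \<eta> - N) = N" using N(2) sets.sets_into_space by (auto dest!: null_setsD2)
    then show "emeasure \<eta> (space \<eta> - (space \<eta> - N)) = 0" using N by auto
    have "h x = f x \<and> x \<in> S1" if "x \<in> space \<eta> - N" for x
      using that N(1) by (auto simp: f0_def)
    then show "inj_on h (space \<eta> - N)"
      using bij by (intro inj_onI) (metis bij_betw_def inj_onD)
  qed
qed

section \<open>Total variation of differences of probability measures, and its measurability along
  kernels\<close>

section \<open>Total variation of kernels\<close>

text \<open>The difference has total mass zero, so in any partition the negative blocks cancel the
  nonnegative ones and the sum of absolute values is twice the value on the union of the latter.
  Conversely, a set and its complement form a partition.\<close>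

lemma total_variation_norm_diff_prob:
  assumes a: "prob_space a" "sets a = sets M" and b: "prob_space b" "sets b = sets M"
  shows "total_variation_norm M (\<lambda>A. measure a A - measure b A) =
    (SUP A\<in>sets M. 2 * ennreal \<bar>measure a A - measure b A\<bar>)" (is "_ = ?R")
proof (rule antisym)
  interpret a: prob_space a by fact
  interpret b: prob_space b by fact
  define \<theta> where "\<theta> A = measure a A - measure b A" for A
  have sp: "space a = space M" "space b = space M"
    using a(2) b(2) by (auto dest: sets_eq_imp_space_eq)
  have th0: "\<theta> {} = 0" and th1: "\<theta> (space M) = 0"
    using a.prob_space b.prob_space by (simp_all add: \<theta>_def sp)
  have compl: "\<theta> (space M - A) = - \<theta> A" if "A \<in> sets M" for A
    using a.prob_compl[of A] b.prob_compl[of A] that a(2) b(2) by (simp add: \<theta>_def sp)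
  have union: "(\<Sum>A\<in>\<C>. \<theta> A) = \<theta> (\<Union>\<C>)"
    if "finite \<C>" "\<C> \<subseteq> sets M" "disjoint \<C>" for \<C>
    using that a(2) b(2)
      measure_Union'[of \<C> a] measure_Union'[of \<C> b]
    by (simp add: \<theta>_def sum_subtractf fmeasurable_def subset_eq a.emeasure_finite less_top[symmetric])
  show "total_variation_norm M (\<lambda>A. measure a A - measure b A) \<le> ?R"
    unfolding total_variation_norm_def
  proof (rule SUP_least)
    fix \<A> assume "\<A> \<in> {\<A>. finite \<A> \<and> \<A> \<subseteq> sets M \<and> partition_on (space M) \<A>}"
    then have \<A>: "finite \<A>" "\<A> \<subseteq> sets M" "\<Union>\<A> = space M" "disjoint \<A>"
      by (auto simp: partition_on_def)
    define p where "p = {A\<in>\<A>. \<theta> A \<ge> 0}"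
    define n where "n = {A\<in>\<A>. \<theta> A < 0}"
    have pn: "\<A> = p \<union> n" "p \<inter> n = {}" "p \<subseteq> \<A>" "n \<subseteq> \<A>" by (auto simp: p_def n_def)
    have fin: "finite p" "finite n" using \<A>(1) pn by (auto intro: finite_subset)
    have "(\<Sum>A\<in>\<A>. \<bar>\<theta> A\<bar>) = (\<Sum>A\<in>p. \<bar>\<theta> A\<bar>) + (\<Sum>A\<in>n. \<bar>\<theta> A\<bar>)"
      unfolding pn(1) using fin pn(2) by (rule sum.union_disjoint)
    also have "\<dots> = (\<Sum>A\<in>p. \<theta> A) - (\<Sum>A\<in>n. \<theta> A)"
      by (simp add: p_def n_def sum_negf)
    \<comment> \<open>This equation only serves to evaluate the negative part as minus the positive
      part, which is then substituted into the running calculation.\<close>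
    also have "(\<Sum>A\<in>p. \<theta> A) + (\<Sum>A\<in>n. \<theta> A) = (\<Sum>A\<in>\<A>. \<theta> A)"
      unfolding pn(1) using fin pn(2) by (rule sum.union_disjoint[symmetric])
    then have "(\<Sum>A\<in>n. \<theta> A) = - (\<Sum>A\<in>p. \<theta> A)"
      using union[OF \<A>(1,2,4)] \<A>(3) th1 by simp
    also have "(\<Sum>A\<in>p. \<theta> A) = \<theta> (\<Union>p)"
      using pn \<A>(2,4) by (intro union fin) (auto simp: disjoint_def)
    finally have eq: "(\<Sum>A\<in>\<A>. \<bar>\<theta> A\<bar>) = 2 * \<theta> (\<Union>p)" by simp
    have "(\<Sum>A\<in>\<A>. ennreal \<bar>\<theta> A\<bar>) = ennreal (\<Sum>A\<in>\<A>. \<bar>\<theta> A\<bar>)"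
      by (rule sum_ennreal) simp
    also have "\<dots> \<le> 2 * ennreal \<bar>\<theta> (\<Union>p)\<bar>"
      unfolding eq by (simp add: ennreal_mult' flip: ennreal_numeral) (simp add: ennreal_leI mult_left_mono)
    also have "\<dots> \<le> (SUP A\<in>sets M. 2 * ennreal \<bar>\<theta> A\<bar>)"
      using pn(3) \<A>(2) fin(1) by (intro SUP_upper sets.finite_Union) auto
    finally show "(\<Sum>A\<in>\<A>. ennreal \<bar>measure a A - measure b A\<bar>) \<le> ?R" by (simp add: \<theta>_def)
  qed
  show "?R \<le> total_variation_norm M (\<lambda>A. measure a A - measure b A)"
  proof (rule SUP_least)
    fix A assume A: "A \<in> sets M"
    show "2 * ennreal \<bar>measure a A - measure b A\<bar> \<le> total_variation_norm M (\<lambda>A. measure a A - measure b A)"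
    \<comment> \<open>Blocks of a partition are nonempty, so the two-block partition exists only for
      a proper nonempty \<open>A\<close>; for the other two sets the difference vanishes.\<close>
    proof (cases "A = {} \<or> A = space M")
      case True
      then have "\<theta> A = 0" using th0 th1 by auto
      then show ?thesis by (simp add: \<theta>_def)
    next
      case False
      have sub: "A \<subseteq> space M" using A by (rule sets.sets_into_space)
      have ne: "A \<noteq> space M - A" using False by auto
      have "2 * ennreal \<bar>\<theta> A\<bar> = (\<Sum>B\<in>{A, space M - A}. ennreal \<bar>\<theta> B\<bar>)"
      proof -
        have "(\<Sum>B\<in>{A, space M - A}. ennreal \<bar>\<theta> B\<bar>) = ennreal \<bar>\<theta> A\<bar> + ennreal \<bar>\<theta> (space M - A)\<bar>"
          by (subst sum.insert) (use ne in auto)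
        then show ?thesis unfolding compl[OF A] by (simp add: mult_2)
      qed
      also have "\<dots> \<le> total_variation_norm M \<theta>"
        unfolding total_variation_norm_def
        using A sub False by (intro SUP_upper) (auto simp: partition_on_def disjoint_def)
      finally show ?thesis by (simp add: \<theta>_def[abs_def])
    qed
  qed
qed

lemma (in finite_measure) abs_measure_diff_le_sym_diff:
  assumes "A \<in> sets M" "B \<in> sets M"
  shows "\<bar>measure M A - measure M B\<bar> \<le> measure M (sym_diff A B)"
proof -
  have "measure M X \<le> measure M Y + measure M (sym_diff A B)"
    if "X \<in> sets M" "Y \<in> sets M" "X \<subseteq> Y \<union> sym_diff A B" for X Y
  proof -
    have "measure M X \<le> measure M (Y \<union> sym_diff A B)"
      using that assms by (intro finite_measure_mono) auto
    also have "\<dots> \<le> measure M Y + measure M (sym_diff A B)"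
      using that assms by (intro measure_Un_le) auto
    finally show ?thesis .
  qed
  moreover have "A \<subseteq> B \<union> sym_diff A B" "B \<subseteq> A \<union> sym_diff A B" by auto
  ultimately have "measure M A \<le> measure M B + measure M (sym_diff A B)"
      "measure M B \<le> measure M A + measure M (sym_diff A B)"
    using assms by metis+
  then show ?thesis by (simp add: abs_le_iff)
qed

text \<open>Supplies a measure that controls two others at once: a set small or negligible for the
  sum is so for both summands.\<close>

lemma finite_measure_add:
  assumes a: "finite_measure a" "sets a = sets M" and b: "finite_measure b" "sets b = sets M"
  obtains \<eta> where "finite_measure \<eta>" "sets \<eta> = sets M"
    "\<And>A. A \<in> sets M \<Longrightarrow> emeasure \<eta> A = emeasure a A + emeasure b A"
proof -
  define \<eta> where "\<eta> = measure_of (space M) (sets M) (\<lambda>A. emeasure a A + emeasure b A)"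
  have s: "sets \<eta> = sets M" by (simp add: \<eta>_def)
  have e: "emeasure \<eta> A = emeasure a A + emeasure b A" if "A \<in> sets M" for A
    unfolding \<eta>_def
  proof (rule emeasure_measure_of_sigma[OF sets.sigma_algebra_axioms _ _ that])
    show "positive (sets M) (\<lambda>A. emeasure a A + emeasure b A)" by (simp add: positive_def)
    show "countably_additive (sets M) (\<lambda>A. emeasure a A + emeasure b A)"
    proof (rule countably_additiveI)
      fix F :: "nat \<Rightarrow> _" assume F: "range F \<subseteq> sets M" "disjoint_family F"
      have "(\<Sum>i. emeasure a (F i) + emeasure b (F i)) = (\<Sum>i. emeasure a (F i)) + (\<Sum>i. emeasure b (F i))"
        by (rule suminf_add[symmetric]) auto
      then show "(\<Sum>i. emeasure a (F i) + emeasure b (F i)) =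
          emeasure a (\<Union>i. F i) + emeasure b (\<Union>i. F i)"
        using F a(2) b(2) by (simp add: suminf_emeasure)
    qed
  qed
  have "finite_measure \<eta>"
    by (rule finite_measureI)
      (use e[of "space M"] finite_measure.emeasure_finite[OF a(1)] finite_measure.emeasure_finite[OF b(1)]
        sets_eq_imp_space_eq[OF s] in simp)
  then show thesis using that s e by blast
qed

text \<open>
  A supremum over all measurable sets need not be measurable. An injective function coming from the
  Rokhlin structure of the average \<open>\<rho>\<close> of the two kernels reduces it to countably many sets:
  for almost every \<open>x\<close> the injectivity set carries both \<open>K x\<close> and \<open>L x\<close>, and the Rokhlin
  structure of \<open>K x + L x\<close> itself yields the approximation.
\<close>

lemma borel_measurable_total_variation_kernels:
  assumes rok: "lebesgue_rokhlin_sigma_algebra M" and \<mu>: "sigma_finite_measure \<mu>" "sets \<mu> = sets M"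
    and K: "K \<in> M \<rightarrow>\<^sub>M prob_algebra M" and L: "L \<in> M \<rightarrow>\<^sub>M prob_algebra M"
  shows "(\<lambda>x. total_variation_norm M (\<lambda>A. measure (K x) A - measure (L x) A))
    \<in> borel_measurable (completion \<mu>)" (is "?tv \<in> _")
proof (cases "space M = {}")
  case True
  then have "space (completion \<mu>) = {}" using sets_eq_imp_space_eq[OF \<mu>(2)] by simp
  then show ?thesis by (auto intro!: measurableI)
next
  case ne: False
  interpret \<mu>: sigma_finite_measure \<mu> by fact
  have sp\<mu>: "space \<mu> = space M" using sets_eq_imp_space_eq[OF \<mu>(2)] .
  obtain w where w: "w \<in> borel_measurable \<mu>" "integral\<^sup>N \<mu> w \<noteq> \<infinity>" "\<And>x. x \<in> space \<mu> \<Longrightarrow> 0 < w x"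
    using \<mu>.Ex_finite_integrable_function by blast
  \<comment> \<open>A finite measure with which to average the kernels; since the weight is strictly
    positive, statements holding almost everywhere for \<open>\<mu>'\<close> hold so for
    \<open>\<mu>\<close>.\<close>
  define \<mu>' where "\<mu>' = density \<mu> w"
  have s': "sets \<mu>' = sets M" and sp': "space \<mu>' = space M" by (simp_all add: \<mu>'_def \<mu> sp\<mu>)
  have fin': "emeasure \<mu>' (space M) < \<infinity>"
  proof -
    have "emeasure \<mu>' (space M) = integral\<^sup>N \<mu> w"
      unfolding \<mu>'_def sp\<mu>[symmetric] using w by (auto simp: emeasure_density intro!: nn_integral_cong)
    then show ?thesis using w(2) by (simp add: less_top)
  qed
  have AE': "AE x in \<mu>. Q x" if "AE x in \<mu>'. Q x" for Q
    using that w AE_density[OF w(1), of Q] AE_space[of \<mu>] unfolding \<mu>'_def by auto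
  have kern: "finite_measure (\<mu>' \<bind> R) \<and> sets (\<mu>' \<bind> R) = sets M \<and>
      (\<forall>A\<in>sets M. emeasure (\<mu>' \<bind> R) A = (\<integral>\<^sup>+x. emeasure (R x) A \<partial>\<mu>'))"
    if R: "R \<in> M \<rightarrow>\<^sub>M prob_algebra M" for R
  proof -
    have Rm: "R \<in> \<mu>' \<rightarrow>\<^sub>M subprob_algebra M"
      using measurable_prob_algebraD[OF R] by (simp add: measurable_cong_sets[OF s' refl])
    have s: "sets (\<mu>' \<bind> R) = sets M"
      using sets_kernel[OF Rm] ne sp' by (intro sets_bind) auto
    have e: "emeasure (\<mu>' \<bind> R) A = (\<integral>\<^sup>+x. emeasure (R x) A \<partial>\<mu>')" if "A \<in> sets M" for A
      using emeasure_bind[OF _ Rm that] ne sp' by auto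
    have "emeasure (\<mu>' \<bind> R) (space M) \<le> (\<integral>\<^sup>+x. 1 \<partial>\<mu>')"
      unfolding e[OF sets.top] using subprob_space_kernel[OF Rm]
      by (intro nn_integral_mono) (simp add: subprob_space.subprob_emeasure_le_1)
    also have "\<dots> < \<infinity>" using fin' sp' by simp
    finally have "finite_measure (\<mu>' \<bind> R)"
      using sets_eq_imp_space_eq[OF s] by (intro finite_measureI) auto
    then show ?thesis using s e by blast
  qed
  obtain \<rho> where \<rho>: "finite_measure \<rho>" "sets \<rho> = sets M"
    "\<And>A. A \<in> sets M \<Longrightarrow> emeasure \<rho> A = (\<integral>\<^sup>+x. emeasure (K x) A \<partial>\<mu>') + (\<integral>\<^sup>+x. emeasure (L x) A \<partial>\<mu>')"
    using finite_measure_add[of "\<mu>' \<bind> K" M "\<mu>' \<bind> L"] kern[OF K] kern[OF L] by metis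
  have rokf: "lebesgue_rokhlin \<eta>" if "finite_measure \<eta>" "sets \<eta> = sets M" for \<eta>
    using rok that unfolding lebesgue_rokhlin_sigma_algebra_def
    by (auto simp: finite_measure_def)
  obtain h :: "'a \<Rightarrow> real" and S where h: "h \<in> borel_measurable \<rho>" and S: "S \<in> sets \<rho>"
    "emeasure \<rho> (space \<rho> - S) = 0" "inj_on h S"
    using rokhlin_injective_function[OF rokf[OF \<rho>(1,2)] \<rho>(1)] by blast
  have sp\<rho>: "space \<rho> = space M" using sets_eq_imp_space_eq[OF \<rho>(2)] .
  have hM: "h \<in> borel_measurable M" using h by (simp add: measurable_cong_sets[OF \<rho>(2) refl])
  have emeas: "(\<lambda>x. emeasure (R x) A) \<in> borel_measurable M"
    if "R \<in> M \<rightarrow>\<^sub>M prob_algebra M" "A \<in> sets M" for R A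
    using measurable_compose[OF measurable_prob_algebraD[OF that(1)] measurable_emeasure_subprob_algebra[OF that(2)]]
    by simp
  have null: "AE x in \<mu>. emeasure (R x) (space M - S) = 0"
    if R: "R \<in> M \<rightarrow>\<^sub>M prob_algebra M" and z: "(\<integral>\<^sup>+x. emeasure (R x) (space M - S) \<partial>\<mu>') = 0" for R
  proof (rule AE')
    have "(\<lambda>x. emeasure (R x) (space M - S)) \<in> borel_measurable \<mu>'"
      using emeas[OF R] S \<rho>(2) by (simp add: measurable_cong_sets[OF s' refl] sets.Diff)
    then show "AE x in \<mu>'. emeasure (R x) (space M - S) = 0"
      using z by (simp add: nn_integral_0_iff_AE)
  qed
  have "(\<integral>\<^sup>+x. emeasure (K x) (space M - S) \<partial>\<mu>') = 0" "(\<integral>\<^sup>+x. emeasure (L x) (space M - S) \<partial>\<mu>') = 0"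
    using \<rho>(3)[of "space M - S"] S \<rho>(2) sp\<rho> by auto
  then have AES: "AE x in \<mu>. emeasure (K x) (space M - S) = 0 \<and> emeasure (L x) (space M - S) = 0"
    using null[OF K] null[OF L] by auto
  obtain b :: "nat \<Rightarrow> real set" where b: "\<And>n. open (b n)"
    "\<And>U. open U \<Longrightarrow> \<exists>k. U = \<Union>{b n |n. n \<in> k}"
    by (rule univ_second_countable_sequence[where 'a=real], rule that)
  define V where "V F = {x\<in>space M. h x \<in> (\<Union>n\<in>F. b n)}" for F
  have V: "V F \<in> sets M" for F
  proof -
    have "V F = h -` (\<Union>n\<in>F. b n) \<inter> space M" by (auto simp: V_def)
    also have "\<dots> \<in> sets M" using hM b(1) by (intro measurable_sets) auto
    finally show ?thesis .
  qed
  \<comment> \<open>There are only countably many finite sets of naturals, so this supremum is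
    measurable.\<close>
  define tv' where "tv' x = (SUP F\<in>Collect finite. 2 * ennreal \<bar>measure (K x) (V F) - measure (L x) (V F)\<bar>)" for x
  have meas: "(\<lambda>x. measure (R x) A) \<in> borel_measurable M"
    if "R \<in> M \<rightarrow>\<^sub>M prob_algebra M" "A \<in> sets M" for R A
    unfolding measure_def using emeas[OF that] by measurable
  have "(\<lambda>x. \<bar>measure (K x) (V F) - measure (L x) (V F)\<bar>) \<in> borel_measurable M" for F
    by (intro borel_measurable_abs borel_measurable_diff meas K L V)
  then have "tv' \<in> borel_measurable M"
    unfolding tv'_def
    by (intro borel_measurable_SUP countable_Collect_finite borel_measurable_times_ennreal
        measurable_compose[OF _ measurable_ennreal]) auto
  then have tv': "tv' \<in> borel_measurable (completion \<mu>)"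
    by (intro measurable_completion) (simp add: measurable_cong_sets[OF \<mu>(2) refl])
  have eq: "?tv x = tv' x"
    if x: "x \<in> space M" and z: "emeasure (K x) (space M - S) = 0" "emeasure (L x) (space M - S) = 0" for x
  proof -
    have p: "prob_space (K x)" "sets (K x) = sets M" "prob_space (L x)" "sets (L x) = sets M"
      using measurable_space[OF K x] measurable_space[OF L x] by (auto simp: space_prob_algebra)
    interpret a: prob_space "K x" by fact
    interpret b: prob_space "L x" by fact
    obtain \<eta> where \<eta>: "finite_measure \<eta>" "sets \<eta> = sets M"
      "\<And>A. A \<in> sets M \<Longrightarrow> emeasure \<eta> A = emeasure (K x) A + emeasure (L x) A"
      using finite_measure_add[of "K x" M "L x"] p a.finite_measure_axioms b.finite_measure_axioms by blast
    have sp\<eta>: "space \<eta> = space M" using sets_eq_imp_space_eq[OF \<eta>(2)] .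
    have "2 * ennreal \<bar>measure (K x) A - measure (L x) A\<bar> \<le> tv' x" if A: "A \<in> sets M" for A
    proof (rule ennreal_le_epsilon)
      fix e :: real assume e: "e > 0"
      \<comment> \<open>Accuracy \<open>e/2\<close> is asked because the formula for the norm
        doubles differences of measures.\<close>
      obtain F where F: "finite F" "emeasure \<eta> (sym_diff A {x\<in>space \<eta>. h x \<in> (\<Union>n\<in>F. b n)}) \<le> ennreal (e/2)"
      proof (rule rokhlin_approximation[OF rokf[OF \<eta>(1,2)] \<eta>(1) b, of h S A "e/2"])
        show "h \<in> borel_measurable \<eta>" using hM by (simp add: measurable_cong_sets[OF \<eta>(2) refl])
        show "S \<in> sets \<eta>" "A \<in> sets \<eta>" "inj_on h S" using S \<rho> \<eta> A by auto
        show "emeasure \<eta> (space \<eta> - S) = 0" using \<eta>(3)[of "space M - S"] S \<rho>(2) z sp\<eta> by auto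
      qed (use e that in auto)
      have sd: "sym_diff A (V F) \<in> sets M" using A V by auto
      have "emeasure (K x) (sym_diff A (V F)) + emeasure (L x) (sym_diff A (V F)) \<le> ennreal (e/2)"
        using F(2) \<eta>(3)[OF sd] by (simp add: V_def sp\<eta>)
      then have "measure (K x) (sym_diff A (V F)) + measure (L x) (sym_diff A (V F)) \<le> e / 2"
        using e by (simp add: a.emeasure_eq_measure b.emeasure_eq_measure flip: ennreal_plus)
      moreover have "\<bar>measure (K x) A - measure (K x) (V F)\<bar> \<le> measure (K x) (sym_diff A (V F))"
        using A V p by (intro a.abs_measure_diff_le_sym_diff) auto
      moreover have "\<bar>measure (L x) A - measure (L x) (V F)\<bar> \<le> measure (L x) (sym_diff A (V F))"
        using A V p by (intro b.abs_measure_diff_le_sym_diff) auto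
      ultimately have "2 * \<bar>measure (K x) A - measure (L x) A\<bar> \<le>
          2 * \<bar>measure (K x) (V F) - measure (L x) (V F)\<bar> + e" by argo
      from ennreal_leI[OF this] have "2 * ennreal \<bar>measure (K x) A - measure (L x) A\<bar> \<le>
          2 * ennreal \<bar>measure (K x) (V F) - measure (L x) (V F)\<bar> + ennreal e"
        using e by (simp add: ennreal_plus ennreal_mult)
      also have "2 * ennreal \<bar>measure (K x) (V F) - measure (L x) (V F)\<bar> \<le> tv' x"
        unfolding tv'_def using F(1) by (intro SUP_upper) auto
      finally show "2 * ennreal \<bar>measure (K x) A - measure (L x) A\<bar> \<le> tv' x + ennreal e"
        by (simp add: add_right_mono)
    qed
    moreover have "tv' x \<le> (SUP A\<in>sets M. 2 * ennreal \<bar>measure (K x) A - measure (L x) A\<bar>)"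
      unfolding tv'_def using V by (intro SUP_mono) auto
    ultimately show ?thesis
      unfolding total_variation_norm_diff_prob[OF p] by (intro antisym SUP_least)
  qed
  have AEeq: "AE x in completion \<mu>. tv' x = ?tv x"
    using AES AE_space[of \<mu>] unfolding AE_completion_iff
    by eventually_elim (use eq sp\<mu> in auto)
  show ?thesis
  proof (rule measurableI)
    fix B :: "ennreal set" assume B: "B \<in> sets borel"
    show "?tv -` B \<inter> space (completion \<mu>) \<in> sets (completion \<mu>)"
    \<comment> \<open>The two preimages differ by a null set only, so completeness of the measure
      transfers measurability from \<open>tv'\<close>.\<close>
    proof (rule completion.in_sets_AE)
      show "tv' -` B \<inter> space (completion \<mu>) \<in> sets (completion \<mu>)" using tv' B by (rule measurable_sets)
      show "AE x in completion \<mu>. (x \<in> tv' -` B \<inter> space (completion \<mu>)) = (x \<in> ?tv -` B \<inter> space (completion \<mu>))"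
        using AEeq by eventually_elim auto
    qed auto
  qed auto
qed

section \<open>Pointwise bounds for the discrepancy of a product\<close>

section \<open>Discrepancy of operator products\<close>

text \<open>As the initial measure has mass one, the constant \<open>c\<close> can be moved under
  the integral, and the triangle inequality for integrals applies. In the application
  \<open>c\<close> is the value of \<open>P e\<close> on \<open>A\<close> for an identity
  \<open>e\<close>.\<close>

lemma (in prob_space) measure_bind_deviation:
  assumes sM: "sets M = sets N" and P: "P \<in> N \<rightarrow>\<^sub>M prob_algebra N" and A: "A \<in> sets N"
    and D: "AE k in M. 2 * ennreal \<bar>measure (P k) A - c\<bar> \<le> D k"
  shows "2 * ennreal \<bar>measure (M \<bind> P) A - c\<bar> \<le> (\<integral>\<^sup>+k. D k \<partial>M)"
proof -
  have Pm: "P \<in> M \<rightarrow>\<^sub>M subprob_algebra N"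
    using measurable_prob_algebraD[OF P] by (simp add: measurable_cong_sets[OF sM refl])
  have PA: "(\<lambda>k. measure (P k) A) \<in> borel_measurable M"
    unfolding measure_def
    by (intro measurable_compose[OF measurable_compose[OF Pm measurable_emeasure_subprob_algebra[OF A]]]) simp
  have int: "integrable M (\<lambda>k. measure (P k) A)"
    using PA subprob_space_kernel[OF Pm]
    by (intro integrable_const_bound[where B=1])
      (auto simp: subprob_space.subprob_measure_le_1)
  have eq: "measure (M \<bind> P) A - c = (\<integral>k. measure (P k) A - c \<partial>M)"
    using int by (simp add: measure_bind[OF Pm A] prob_space)
  have "ennreal \<bar>measure (M \<bind> P) A - c\<bar> \<le> (\<integral>\<^sup>+k. ennreal \<bar>measure (P k) A - c\<bar> \<partial>M)"
    unfolding eq using integral_norm_bound_ennreal[of M "\<lambda>k. measure (P k) A - c"] int by simp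
  then have "2 * ennreal \<bar>measure (M \<bind> P) A - c\<bar> \<le> 2 * (\<integral>\<^sup>+k. ennreal \<bar>measure (P k) A - c\<bar> \<partial>M)"
    by (intro mult_left_mono) auto
  also have "\<dots> = (\<integral>\<^sup>+k. 2 * ennreal \<bar>measure (P k) A - c\<bar> \<partial>M)"
    using PA by (intro nn_integral_cmult[symmetric])
      (intro measurable_compose[OF _ measurable_ennreal] borel_measurable_abs borel_measurable_diff, auto)
  also have "\<dots> \<le> (\<integral>\<^sup>+k. D k \<partial>M)" by (rule nn_integral_mono_AE[OF D])
  finally show ?thesis .
qed

context measurable_groupoid
begin

lemma ident_tgt_measurable: "(\<lambda>g. ident G (tgt G g)) \<in> M \<rightarrow>\<^sub>M M"
  by (rule measurable_compose[OF tgt_measurable ident_measurable])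

lemma transition_operatorD:
  assumes "equivariant_transition_operator G M P" "g \<in> Mor G"
  shows "prob_space (P g)" "sets (P g) = sets M" "AE k in P g. k \<in> Mor G \<and> tgt G k = tgt G g"
proof -
  have m: "P \<in> M \<rightarrow>\<^sub>M prob_algebra M" and f: "emeasure (P g) (target_fibre G (tgt G g)) = 1"
    using assms by (auto simp: equivariant_transition_operator_def)
  show p: "prob_space (P g)" and "sets (P g) = sets M"
    using measurable_space[OF m, of g] assms(2) by (auto simp: space_M space_prob_algebra)
  have "AE k in P g. k \<in> target_fibre G (tgt G g)"
    using prob_space.AE_prob_1[OF p] f by (simp add: measure_def)
  then show "AE k in P g. k \<in> Mor G \<and> tgt G k = tgt G g"
    by eventually_elim (simp add: target_fibre_def)
qed

lemma discrepancy_eq_SUP: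
  assumes "equivariant_transition_operator G M P" "g \<in> Mor G"
  shows "discrepancy G M P g =
    (SUP A\<in>sets M. 2 * ennreal \<bar>measure (P g) A - measure (P (ident G (tgt G g))) A\<bar>)"
  unfolding discrepancy_def
  by (intro total_variation_norm_diff_prob transition_operatorD[OF assms(1)] assms(2) ident_closed tgt_closed)

text \<open>Both initial measures live on one target fibre, so \<open>P e\<close>, with
  \<open>e\<close> the identity there, is a common centre for the two deviations. The function
  \<open>D\<close> leaves room for a measurable representative of the discrepancy.\<close>

lemma discrepancy_operator_product_le:
  assumes P: "equivariant_transition_operator G M P" and Q: "equivariant_transition_operator G M Q"
    and g: "g \<in> Mor G"
    and D: "AE k in Q g. D k = discrepancy G M P k"
      "AE k in Q (ident G (tgt G g)). D k = discrepancy G M P k"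
  shows "discrepancy G M (operator_product Q P) g \<le>
    (\<integral>\<^sup>+k. D k \<partial>Q g) + (\<integral>\<^sup>+k. D k \<partial>Q (ident G (tgt G g)))"
proof -
  define e where "e = ident G (tgt G g)"
  have e: "e \<in> Mor G" "tgt G e = tgt G g" using g by (auto simp: e_def ident_closed tgt_closed tgt_ident)
  have Pm: "P \<in> M \<rightarrow>\<^sub>M prob_algebra M" using P by (simp add: equivariant_transition_operator_def)
  have dev: "2 * ennreal \<bar>measure (Q h \<bind> P) A - measure (P e) A\<bar> \<le> (\<integral>\<^sup>+k. D k \<partial>Q h)"
    if h: "h \<in> Mor G" "tgt G h = tgt G g" and A: "A \<in> sets M"
      and Dh: "AE k in Q h. D k = discrepancy G M P k" for h A
  proof (rule prob_space.measure_bind_deviation[OF transition_operatorD(1,2)[OF Q h(1)] Pm A])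
    \<comment> \<open>Almost every \<open>k\<close> has the target of \<open>g\<close>, so its
      discrepancy compares \<open>P k\<close> with this same \<open>P e\<close>.\<close>
    show "AE k in Q h. 2 * ennreal \<bar>measure (P k) A - measure (P e) A\<bar> \<le> D k"
      using transition_operatorD(3)[OF Q h(1)] Dh
    proof eventually_elim
      case (elim k)
      then show ?case
        using discrepancy_eq_SUP[OF P, of k] A h(2) by (auto simp: e_def intro: SUP_upper)
    qed
  qed
  show ?thesis
    unfolding discrepancy_eq_SUP[OF equivariant_operator_product[OF Q P] g] e_def[symmetric]
  proof (rule SUP_least)
    fix A assume A: "A \<in> sets M"
    let ?a = "\<bar>measure (Q g \<bind> P) A - measure (P e) A\<bar>"
    let ?b = "\<bar>measure (Q e \<bind> P) A - measure (P e) A\<bar>"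
    have "2 * ennreal \<bar>measure (Q g \<bind> P) A - measure (Q e \<bind> P) A\<bar> \<le> 2 * ennreal (?a + ?b)"
      by (intro mult_left_mono ennreal_leI) auto
    also have "\<dots> = 2 * ennreal ?a + 2 * ennreal ?b"
      by (simp add: ennreal_plus distrib_left)
    also have "\<dots> \<le> (\<integral>\<^sup>+k. D k \<partial>Q g) + (\<integral>\<^sup>+k. D k \<partial>Q e)"
      using g e A D unfolding e_def[symmetric] by (intro add_mono dev) auto
    finally show "2 * ennreal \<bar>measure (operator_product Q P g) A - measure (operator_product Q P e) A\<bar> \<le>
        (\<integral>\<^sup>+k. D k \<partial>Q g) + (\<integral>\<^sup>+k. D k \<partial>Q e)"
      by (simp add: operator_product_def)
  qed
qed

end

section \<open>Negligible sets on target fibres and absolute continuity\<close>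

context measured_groupoid
begin

text \<open>The discrepancy is the total variation distance between the kernel \<open>R\<close> and
  its composition with the map sending \<open>g\<close> to the identity at its target.\<close>

lemma borel_measurable_discrepancy:
  assumes "equivariant_transition_operator G M R"
  shows "discrepancy G M R \<in> borel_measurable (completion (star_measure M \<Lambda> \<kappa>))"
proof -
  have R: "R \<in> M \<rightarrow>\<^sub>M prob_algebra M" using assms by (simp add: equivariant_transition_operator_def)
  show ?thesis
    unfolding discrepancy_def[abs_def]
    by (rule borel_measurable_total_variation_kernels[OF rokhlin_M sigma_finite_star sets_star_measure R
          measurable_compose[OF ident_tgt_measurable R]])
qed

text \<open>By the integral formula, \<open>N\<close> has positive fibre measure only over a
  \<open>\<kappa>\<close>-null set \<open>Z\<close> of objects. The morphisms with target in
  \<open>Z\<close> are then negligible for the star measure, hence for \<open>m\<close>.\<close>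

lemma null_set_null_on_fibres:
  assumes N: "N \<in> null_sets (star_measure M \<Lambda> \<kappa>)" and m: "sets m = sets M"
    and ac: "absolutely_continuous (star_measure M \<Lambda> \<kappa>) m"
  shows "AE g in m. emeasure (\<Lambda> (tgt G g)) N = 0"
proof -
  have fib: "fibred_system G M \<Lambda>" using haar by (simp add: haar_system_def)
  have sp: "space \<kappa> = Obj G"
    using sets_eq_imp_space_eq[OF sets_base] by (simp add: obj_space_def)
  have sL: "sets (\<Lambda> x) = sets M" and AEL: "AE g in \<Lambda> x. g \<in> target_fibre G x" if "x \<in> Obj G" for x
    using fib that by (auto simp: fibred_system_def)
  have NM: "N \<in> sets M" using N by auto
  have "(\<lambda>x. \<integral>\<^sup>+ g. indicator N g \<partial>\<Lambda> x) \<in> borel_measurable \<kappa>"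
    using fib NM by (simp add: fibred_system_def measurable_cong_sets[OF sets_base refl])
  then have meas: "(\<lambda>x. emeasure (\<Lambda> x) N) \<in> borel_measurable \<kappa>"
    by (rule measurable_cong[THEN iffD1, rotated]) (use sL sp NM in auto)
  define Z where "Z = {x\<in>space \<kappa>. emeasure (\<Lambda> x) N \<noteq> 0}"
  have "(\<integral>\<^sup>+x. emeasure (\<Lambda> x) N \<partial>\<kappa>) = 0"
    using N emeasure_star_measure[OF fib sets_base NM] by auto
  then have AEZ: "AE x in \<kappa>. x \<notin> Z"
    using meas by (auto simp: nn_integral_0_iff_AE Z_def elim: eventually_mono)
  have "Z \<in> sets \<kappa>" unfolding Z_def using meas by measurable
  then have TZ: "tgt G -` Z \<inter> space M \<in> sets M"
    using measurable_sets[OF tgt_measurable] sets_base by simp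
  have "emeasure (star_measure M \<Lambda> \<kappa>) (tgt G -` Z \<inter> space M) = (\<integral>\<^sup>+x. emeasure (\<Lambda> x) (tgt G -` Z \<inter> space M) \<partial>\<kappa>)"
    by (rule emeasure_star_measure[OF fib sets_base TZ])
  also have "\<dots> = (\<integral>\<^sup>+x. 0 \<partial>\<kappa>)"
  proof (rule nn_integral_cong_AE, use AEZ AE_space in eventually_elim)
    case (elim x)
    then have x: "x \<in> Obj G" using sp by simp
    \<comment> \<open>\<open>\<Lambda> x\<close> is concentrated on morphisms with target
      \<open>x\<close>, and \<open>x\<close> lies outside \<open>Z\<close>.\<close>
    have "AE g in \<Lambda> x. g \<notin> tgt G -` Z \<inter> space M"
      using AEL[OF x] by eventually_elim (use elim in \<open>auto simp: target_fibre_def\<close>)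
    moreover have "tgt G -` Z \<inter> space M \<in> sets (\<Lambda> x)" using TZ sL[OF x] by simp
    ultimately show ?case by (simp only: AE_iff_null_sets[symmetric] null_setsD1)
  qed
  finally have "tgt G -` Z \<inter> space M \<in> null_sets m"
    using ac TZ by (auto simp: absolutely_continuous_def null_sets_def)
  then have "AE g in m. g \<notin> tgt G -` Z \<inter> space M" by (rule AE_not_in)
  then show ?thesis
    using AE_space
  proof eventually_elim
    case (elim g)
    then have "g \<in> Mor G" using sets_eq_imp_space_eq[OF m] space_M by simp
    then show ?case using elim tgt_closed sp space_M by (auto simp: Z_def)
  qed
qed

text \<open>A star-negligible set is null for the fibre measure at the target of almost every
  \<open>g\<close>, hence for \<open>R g\<close>. This makes the ISAI condition applicable to
  \<open>m \<bind> R\<close>, both for \<open>Q\<close> and for \<open>Q\<close> started at the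
  target identity.\<close>

lemma bind_absolutely_continuous:
  assumes R: "R \<in> M \<rightarrow>\<^sub>M prob_algebra M"
    and acR: "\<And>g. g \<in> Mor G \<Longrightarrow> absolutely_continuous (\<Lambda> (tgt G g)) (R g)"
    and m: "prob_space m" "sets m = sets M" "absolutely_continuous (star_measure M \<Lambda> \<kappa>) m"
  shows "prob_space (m \<bind> R)" "sets (m \<bind> R) = sets M"
    "absolutely_continuous (star_measure M \<Lambda> \<kappa>) (m \<bind> R)"
proof -
  interpret m: prob_space m by fact
  have spm: "space m = Mor G" using sets_eq_imp_space_eq[OF m(2)] space_M by simp
  have Rp: "R \<in> m \<rightarrow>\<^sub>M prob_algebra M" using R by (simp add: measurable_cong_sets[OF m(2) refl])
  note Rm = measurable_prob_algebraD[OF Rp]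
  have "prob_space (R g)" if "g \<in> space m" for g
    using measurable_space[OF Rp that] by (simp add: space_prob_algebra)
  then show "prob_space (m \<bind> R)" by (intro m.prob_space_bind[OF _ Rm] AE_I2)
  show "sets (m \<bind> R) = sets M"
    using sets_kernel[OF Rm] m.not_empty by (intro sets_bind) auto
  show "absolutely_continuous (star_measure M \<Lambda> \<kappa>) (m \<bind> R)"
    unfolding absolutely_continuous_def
  proof
    fix N assume N: "N \<in> null_sets (star_measure M \<Lambda> \<kappa>)"
    then have NM: "N \<in> sets M" by auto
    have "emeasure (m \<bind> R) N = (\<integral>\<^sup>+g. emeasure (R g) N \<partial>m)"
      by (rule emeasure_bind[OF m.not_empty Rm NM])
    also have "\<dots> = (\<integral>\<^sup>+g. 0 \<partial>m)"
    proof (rule nn_integral_cong_AE, use null_set_null_on_fibres[OF N m(2,3)] AE_space in eventually_elim)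
      case (elim g)
      then have g: "g \<in> Mor G" using spm by simp
      have "sets (\<Lambda> (tgt G g)) = sets M"
        using haar tgt_closed[OF g] by (auto simp: haar_system_def fibred_system_def)
      then show ?case using absolutely_continuousD[OF acR[OF g]] NM elim by simp
    qed
    finally show "N \<in> null_sets (m \<bind> R)"
      using NM \<open>sets (m \<bind> R) = sets M\<close> by (auto simp: null_sets_def)
  qed
qed

end

section \<open>Integrated discrepancies of the products and their limit\<close>

theorem proposition35:
  fixes G :: "('x, 'g) groupoid_data" and M :: "'g measure"
    and \<Lambda> :: "'x \<Rightarrow> 'g measure" and \<kappa> :: "'x measure"
    and P :: "nat \<Rightarrow> 'g \<Rightarrow> 'g measure" and Q :: "'g \<Rightarrow> 'g measure"
  assumes "measured_groupoid G M \<Lambda> \<kappa>"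
    and "\<And>n. equivariant_transition_operator G M (P n)"
    and "isai G M \<Lambda> \<kappa> P"
    and "equivariant_transition_operator G M Q"
    and "absolutely_continuous_transitions G \<Lambda> Q"
  shows "isai G M \<Lambda> \<kappa> (\<lambda>n. operator_product Q (P n))"
proof -
  interpret measured_groupoid G M \<Lambda> \<kappa> by fact
  let ?S = "star_measure M \<Lambda> \<kappa>"
  have Qm: "Q \<in> M \<rightarrow>\<^sub>M prob_algebra M" using assms(4) by (simp add: equivariant_transition_operator_def)
  \<comment> \<open>The kernel behind the second term of the pointwise bound; its absolute
    continuity is that of \<open>Q\<close> at the identity, which has the same target as
    \<open>g\<close>.\<close>
  define Q' where "Q' g = Q (ident G (tgt G g))" for g
  have Q'm: "Q' \<in> M \<rightarrow>\<^sub>M prob_algebra M"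
    unfolding Q'_def by (rule measurable_compose[OF ident_tgt_measurable Qm])
  have acQ: "absolutely_continuous (\<Lambda> (tgt G g)) (Q g)" if "g \<in> Mor G" for g
    using assms(5) that by (simp add: absolutely_continuous_transitions_def)
  have acQ': "absolutely_continuous (\<Lambda> (tgt G g)) (Q' g)" if "g \<in> Mor G" for g
    using acQ[OF ident_closed[OF tgt_closed[OF that]]] that by (simp add: Q'_def tgt_ident tgt_closed)
  have "(\<lambda>n. \<integral>\<^sup>+g. discrepancy G M (operator_product Q (P n)) g \<partial>m) \<longlonglongrightarrow> 0"
    if m: "prob_space m" "sets m = sets M" "absolutely_continuous ?S m" for m
  proof -
    note b = bind_absolutely_continuous[OF Qm acQ m]
    note b' = bind_absolutely_continuous[OF Q'm acQ' m]
    have le: "(\<integral>\<^sup>+g. discrepancy G M (operator_product Q (P n)) g \<partial>m) \<le>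
        (\<integral>\<^sup>+g. discrepancy G M (P n) g \<partial>(m \<bind> Q)) + (\<integral>\<^sup>+g. discrepancy G M (P n) g \<partial>(m \<bind> Q'))" for n
    proof -
      \<comment> \<open>The discrepancy is known to be measurable only for the completion, while
        integration against \<open>m \<bind> Q\<close> by iterated integrals requires measurability
        on \<open>M\<close>.\<close>
      obtain D where "D \<in> borel_measurable ?S" and D: "AE g in ?S. discrepancy G M (P n) g = D g"
        using completion_ex_borel_measurable[OF borel_measurable_discrepancy[OF assms(2)]] by blast
      then have Dm: "D \<in> borel_measurable M" by (simp add: measurable_cong_sets[OF sets_star_measure refl])
      obtain N where N: "{g\<in>space M. discrepancy G M (P n) g \<noteq> D g} \<subseteq> N" "N \<in> null_sets ?S"
        using D unfolding eventually_ae_filter by auto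
      \<comment> \<open>For \<open>m\<close>-almost every \<open>g\<close> the exceptional set
        \<open>N\<close> is null on the fibre, so the representative agrees with the discrepancy
        almost everywhere for each transition probability used in the bound.\<close>
      have ker: "AE k in R g. D k = discrepancy G M (P n) k"
        if R: "R \<in> M \<rightarrow>\<^sub>M prob_algebra M" and g: "g \<in> Mor G"
          and ac: "absolutely_continuous (\<Lambda> (tgt G g)) (R g)" and z: "emeasure (\<Lambda> (tgt G g)) N = 0" for R g
      proof -
        have sR: "sets (R g) = sets M"
          using measurable_space[OF R, of g] g by (simp add: space_M space_prob_algebra)
        have "sets (\<Lambda> (tgt G g)) = sets M"
          using haar tgt_closed[OF g] by (auto simp: haar_system_def fibred_system_def)
        then have "N \<in> null_sets (R g)"
          using absolutely_continuousD[OF ac _ z] N(2) sR by (auto simp: null_sets_def)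
        then show ?thesis
          using N(1) sets_eq_imp_space_eq[OF sR] by (intro AE_I'[of N]) auto
      qed
      have Rint: "(\<lambda>g. \<integral>\<^sup>+k. D k \<partial>R g) \<in> borel_measurable m"
        and Rbind: "(\<integral>\<^sup>+k. D k \<partial>(m \<bind> R)) = (\<integral>\<^sup>+g. \<integral>\<^sup>+k. D k \<partial>R g \<partial>m)"
        if R: "R \<in> M \<rightarrow>\<^sub>M prob_algebra M" for R
      proof -
        have Rm: "R \<in> m \<rightarrow>\<^sub>M subprob_algebra M"
          using measurable_prob_algebraD[OF R] by (simp add: measurable_cong_sets[OF m(2) refl])
        show "(\<lambda>g. \<integral>\<^sup>+k. D k \<partial>R g) \<in> borel_measurable m"
          by (rule measurable_compose[OF Rm nn_integral_measurable_subprob_algebra[OF Dm]])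
        show "(\<integral>\<^sup>+k. D k \<partial>(m \<bind> R)) = (\<integral>\<^sup>+g. \<integral>\<^sup>+k. D k \<partial>R g \<partial>m)"
          by (rule nn_integral_bind[OF Dm Rm])
      qed
      have "(\<integral>\<^sup>+g. discrepancy G M (operator_product Q (P n)) g \<partial>m) \<le>
          (\<integral>\<^sup>+g. (\<integral>\<^sup>+k. D k \<partial>Q g) + (\<integral>\<^sup>+k. D k \<partial>Q' g) \<partial>m)"
      proof (rule nn_integral_mono_AE, use null_set_null_on_fibres[OF N(2) m(2,3)] AE_space in eventually_elim)
        case (elim g)
        then have g: "g \<in> Mor G" using sets_eq_imp_space_eq[OF m(2)] space_M by simp
        show ?case
          unfolding Q'_def
          by (intro discrepancy_operator_product_le[OF assms(2,4) g] ker[OF Qm g acQ[OF g] elim(1)]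
              ker[OF Q'm g acQ'[OF g] elim(1), unfolded Q'_def])
      qed
      also have "\<dots> = (\<integral>\<^sup>+k. D k \<partial>(m \<bind> Q)) + (\<integral>\<^sup>+k. D k \<partial>(m \<bind> Q'))"
        using Rint[OF Qm] Rint[OF Q'm] by (simp add: nn_integral_add Rbind[OF Qm] Rbind[OF Q'm])
      \<comment> \<open>Absolute continuity of \<open>m \<bind> Q\<close> allows the return from the
        representative to the discrepancy itself.\<close>
      also have "(\<integral>\<^sup>+k. D k \<partial>(m \<bind> Q)) = (\<integral>\<^sup>+g. discrepancy G M (P n) g \<partial>(m \<bind> Q))"
        using absolutely_continuous_AE[OF _ b(3) D] b(2)
        by (intro nn_integral_cong_AE) (auto elim: eventually_mono)
      also have "(\<integral>\<^sup>+k. D k \<partial>(m \<bind> Q')) = (\<integral>\<^sup>+g. discrepancy G M (P n) g \<partial>(m \<bind> Q'))"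
        using absolutely_continuous_AE[OF _ b'(3) D] b'(2)
        by (intro nn_integral_cong_AE) (auto elim: eventually_mono)
      finally show ?thesis .
    qed
    have "(\<lambda>n. (\<integral>\<^sup>+g. discrepancy G M (P n) g \<partial>(m \<bind> Q)) +
        (\<integral>\<^sup>+g. discrepancy G M (P n) g \<partial>(m \<bind> Q'))) \<longlonglongrightarrow> 0 + 0"
    proof (rule tendsto_add)
      have lim: "(\<lambda>n. \<integral>\<^sup>+g. discrepancy G M (P n) g \<partial>m') \<longlonglongrightarrow> 0"
        if "prob_space m'" "sets m' = sets M" "absolutely_continuous ?S m'" for m'
        using assms(3) that by (simp add: isai_def)
      show "(\<lambda>n. \<integral>\<^sup>+g. discrepancy G M (P n) g \<partial>(m \<bind> Q)) \<longlonglongrightarrow> 0" by (rule lim[OF b])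
      show "(\<lambda>n. \<integral>\<^sup>+g. discrepancy G M (P n) g \<partial>(m \<bind> Q')) \<longlonglongrightarrow> 0" by (rule lim[OF b'])
    qed
    then have "(\<lambda>n. (\<integral>\<^sup>+g. discrepancy G M (P n) g \<partial>(m \<bind> Q)) +
        (\<integral>\<^sup>+g. discrepancy G M (P n) g \<partial>(m \<bind> Q'))) \<longlonglongrightarrow> 0" by simp
    with tendsto_const show ?thesis
      by (rule tendsto_sandwich[rotated 2]) (use le in auto)
  qed
  then show ?thesis
    unfolding isai_def
    using borel_measurable_discrepancy[OF equivariant_operator_product[OF assms(4,2)]] by blast
qed

end
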